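(* Let $\mathbf{var}$ be a countably infinite set. Every projectional semilattice is isomorphic to a conjunctive table algebra (with equality). That is, for every projectional semilattice $(V,\wedge,0,1,c_x,d_{xy},\mathrm{dom})_{x,y\in\mathbf{var}}$ there are a set $G$, a subalgebra of $\mathbf{Tab}(G)$ with universe $A\subseteq\mathrm{Tab}(G)$, and a bijection $\varphi:V\to A$ such that for all $u,v\in V$ and $x,y\in\mathbf{var}$: $\varphi(u\wedge v)=\varphi(u)\Join\varphi(v)$, $\varphi(0)=\emptyset$, $\varphi(1)=\{\langle\rangle\}$, $\varphi(c_x(u))=\mathrm{del}_x(\varphi(u))$, $\varphi(d_{xy})=E_{xy}$, and $\mathrm{schema}(\varphi(u))=\mathrm{dom}(u)$.
   Context: **Tables.** $\mathfrak{P}_{\mathrm{fin}}(\mathbf{var})$ is the set of finite subsets of $\mathbf{var}$. A table over $G$ is a set $T\subseteq G^X$ of functions $X\to G$, for some $X\in\mathfrak{P}_{\mathrm{fin}}(\mathbf{var})$; $\mathrm{Tab}(G)=\bigcup\{\mathfrak{P}(G^X)\mid X\in\mathfrak{P}_{\mathrm{fin}}(\mathbf{var})\}$ is the set of all tables over $G$ (there is a single empty table $\emptyset$). The function $\mathrm{schema}:\mathrm{Tab}(G)\to\mathfrak{P}(\mathbf{var})$ is given by $\mathrm{schema}(T)=X$ if $\emptyset\neq T\subseteq G^X$, and $\mathrm{schema}(\emptyset)=\mathbf{var}$. $\langle\rangle$ is the unique element of $G^{\emptyset}$. - Natural join: for nonempty $T_1\subseteq G^{X_1}$, $T_2\subseteq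 G^{X_2}$, $T_1\Join T_2=\{t\in G^{X_1\cup X_2}\mid t|_{X_1}\in T_1 \text{ and } t|_{X_2}\in T_2\}$; and $\emptyset\Join T=T\Join\emptyset=\emptyset$. - Deletion: for $T\subseteq G^X$, $\mathrm{del}_x(T)=\{t|_{X\setminus\{x\}}\mid t\in T\}$ (so $\mathrm{del}_x(\emptyset)=\emptyset$). - Equality tables: $E_{xy}=\{t\in G^{\{x,y\}}\mid t(x)=t(y)\}$ for $x,y\in\mathbf{var}$ (possibly $x=y$). $\mathbf{Tab}(G)=(\mathrm{Tab}(G),\Join,\emptyset,\{\langle\rangle\},\mathrm{del}_x,E_{xy},\mathrm{schema})_{x,y\in\mathbf{var}}$. A conjunctive table algebra (with equality) with base $G$ is a subalgebra of $\mathbf{Tab}(G)$, i.e. a subset $A\subseteq\mathrm{Tab}(G)$ containing $\emptyset$, $\{\langle\rangle\}$ and all $E_{xy}$, closed under $\Join$ and all $\mathrm{del}_x$, equipped with the restricted operations. **Projectional semilattice.** An algebra $(V,\wedge,0,1,c_x,d_{xy},\mathrm{dom})_{x,y\in\mathbf{var}}$ with a binary operation $\wedge$ on $V$, elements $0,1\in V$, functions $c_x:V\to V$ ($x\in\mathbf{var}$), elements $d_{xy}\in V$ ($x,y\in\mathbf{var}$), and a function $\mathrm{dom}:V\to\mathfrak{P}(\mathbf{var})$, such that for all $u,v\in V$ and $x,y,z\in\mathbf{var}$ (where $u\le v$ means $u=u\wedge v$): - (PS0) $(V,\wedge,0,1)$ is a bounded semilattice ($\wedge$ is associative, commutative and idempotent,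 with least element $0$ and greatest element $1$) - (PS1) $c_x(0)=0$ - (PS2) $u\le c_x(u)$ - (PS3) $c_x(u\wedge c_x(v))=c_x(u)\wedge c_x(v)$ - (PS4) $c_x(c_y(u))=c_y(c_x(u))$ - (PS5) $u\neq 0\Rightarrow(u\neq c_x(u)\Leftrightarrow u\le d_{xx})$ - (PS6) if $x\neq y$ and $x\neq z$, then $d_{yz}=c_x(d_{yx}\wedge d_{xz})$ - (PS7) $x\neq y\Rightarrow d_{xy}\wedge c_x(d_{xy}\wedge u)\le u$ - (PS8) $u\neq0\Rightarrow\mathrm{dom}(u)$ is finite - (PS9) $\mathrm{dom}(u)=\{x\in\mathbf{var}\mid u\le d_{xx}\}$ - (PS10) $\mathrm{dom}(u)=\emptyset\Rightarrow u=1$ - (PS11) $d_{xx}\neq0$ - (PS12) $d_{xy}=d_{yx}$ *)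

theory Defs
  imports Main "HOL-Library.Countable_Set"
begin

text \<open>
  The set of variables is the type \<open>'x\<close>; its being countably infinite is a hypothesis on
  \<open>UNIV :: 'x set\<close> wherever it is needed.

  A function \<open>X \<rightarrow> G\<close> is a partial map with domain exactly \<open>X\<close> and values in \<open>G\<close>, so that a tuple
  determines its domain. (Extensional functions \<open>X \<rightarrow>\<^sub>E G\<close> would not do: functions with different
  domains are identified as soon as \<open>undefined \<in> G\<close>.) The unique element of \<open>G\<^sup>\<emptyset>\<close> is
  \<open>Map.empty\<close>.
\<close>

definition tuples :: "'g set \<Rightarrow> 'x set \<Rightarrow> ('x \<rightharpoonup> 'g) set" where
  "tuples G X = {t. dom t = X \<and> ran t \<subseteq> G}"

definition Tab :: "'g set \<Rightarrow> ('x \<rightharpoonup> 'g) set set" where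
  "Tab G = (\<Union>X\<in>{X. finite X}. Pow (tuples G X))"

definition schema :: "'g set \<Rightarrow> ('x \<rightharpoonup> 'g) set \<Rightarrow> 'x set" where
  "schema G T = (if T = {} then UNIV else (THE X. T \<subseteq> tuples G X))"

definition join :: "'g set \<Rightarrow> ('x \<rightharpoonup> 'g) set \<Rightarrow> ('x \<rightharpoonup> 'g) set \<Rightarrow> ('x \<rightharpoonup> 'g) set" where
  "join G T1 T2 =
     (if T1 = {} \<or> T2 = {} then {}
      else {t \<in> tuples G (schema G T1 \<union> schema G T2).
              t |` schema G T1 \<in> T1 \<and> t |` schema G T2 \<in> T2})"

definition del :: "'g set \<Rightarrow> 'x \<Rightarrow> ('x \<rightharpoonup> 'g) set \<Rightarrow> ('x \<rightharpoonup> 'g) set" where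
  "del G x T = (\<lambda>t. t |` (schema G T - {x})) ` T"

definition eq_table :: "'g set \<Rightarrow> 'x \<Rightarrow> 'x \<Rightarrow> ('x \<rightharpoonup> 'g) set" where
  "eq_table G x y = {t \<in> tuples G {x, y}. t x = t y}"

definition conjunctive_table_algebra :: "'g set \<Rightarrow> ('x \<rightharpoonup> 'g) set set \<Rightarrow> bool" where
  "conjunctive_table_algebra G A \<longleftrightarrow>
     A \<subseteq> Tab G \<and>
     {} \<in> A \<and>
     {Map.empty} \<in> A \<and>
     (\<forall>x y. eq_table G x y \<in> A) \<and>
     (\<forall>T1\<in>A. \<forall>T2\<in>A. join G T1 T2 \<in> A) \<and>
     (\<forall>x. \<forall>T\<in>A. del G x T \<in> A)"

lemma schema_eq:
  assumes "T \<noteq> {}" "T \<subseteq> tuples G X"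
  shows "schema G T = X"
proof -
  have "(THE Y. T \<subseteq> tuples G Y) = X"
    using assms by (intro the_equality) (auto simp: tuples_def)
  with assms(1) show ?thesis by (simp add: schema_def)
qed

text \<open>
  HOL cannot quantify over types inside a formula, so the base \<open>G\<close> of a representation has to be
  a subset of some fixed type. The type below imposes no restriction on which algebras are
  representable. The algebra is infinite (the \<open>d x x\<close> are pairwise distinct), and, every table being
  a relation of finite arity, the statement that given relations on \<open>G\<close> represent the algebra is a
  set of first-order sentences with one relation symbol per element of the algebra. By downward
  Loewenheim-Skolem, a representation over any set therefore gives one over a set of cardinality at
  most that of the algebra. The outer \<open>set\<close> leaves room for bases that are formed as sets of
  equivalence classes.
\<close>

type_synonym ('v, 'x) base = "('v \<times> 'x) list set"

locale projectional_semilattice =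
  fixes V :: "'v set"
    and meet :: "'v \<Rightarrow> 'v \<Rightarrow> 'v"  (infixl \<open>\<sqinter>\<close> 70)
    and zero :: 'v  (\<open>\<zero>\<close>)
    and one :: 'v  (\<open>\<one>\<close>)
    and c :: "'x \<Rightarrow> 'v \<Rightarrow> 'v"
    and d :: "'x \<Rightarrow> 'x \<Rightarrow> 'v"
    and domain :: "'v \<Rightarrow> 'x set"
    and le :: "'v \<Rightarrow> 'v \<Rightarrow> bool"  (infix \<open>\<sqsubseteq>\<close> 50)
  defines "u \<sqsubseteq> v \<equiv> u = u \<sqinter> v"
  assumes meet_closed: "\<lbrakk>u \<in> V; v \<in> V\<rbrakk> \<Longrightarrow> u \<sqinter> v \<in> V"
    and zero_closed: "\<zero> \<in> V"
    and one_closed: "\<one> \<in> V"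
    and c_closed: "u \<in> V \<Longrightarrow> c x u \<in> V"
    and d_closed: "d x y \<in> V"
    and meet_assoc: "\<lbrakk>u \<in> V; v \<in> V; w \<in> V\<rbrakk> \<Longrightarrow> (u \<sqinter> v) \<sqinter> w = u \<sqinter> (v \<sqinter> w)"
    and meet_commute: "\<lbrakk>u \<in> V; v \<in> V\<rbrakk> \<Longrightarrow> u \<sqinter> v = v \<sqinter> u"
    and meet_idem: "u \<in> V \<Longrightarrow> u \<sqinter> u = u"
    and zero_least: "u \<in> V \<Longrightarrow> \<zero> \<sqsubseteq> u"
    and one_greatest: "u \<in> V \<Longrightarrow> u \<sqsubseteq> \<one>"
    and c_zero: "c x \<zero> = \<zero>"
    and c_increasing: "u \<in> V \<Longrightarrow> u \<sqsubseteq> c x u"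
    and c_meet_c: "\<lbrakk>u \<in> V; v \<in> V\<rbrakk> \<Longrightarrow> c x (u \<sqinter> c x v) = c x u \<sqinter> c x v"
    and c_commute: "u \<in> V \<Longrightarrow> c x (c y u) = c y (c x u)"
    and c_noteq_iff: "\<lbrakk>u \<in> V; u \<noteq> \<zero>\<rbrakk> \<Longrightarrow> u \<noteq> c x u \<longleftrightarrow> u \<sqsubseteq> d x x"
    and d_eq_c_meet: "\<lbrakk>x \<noteq> y; x \<noteq> z\<rbrakk> \<Longrightarrow> d y z = c x (d y x \<sqinter> d x z)"
    and d_meet_c_le: "\<lbrakk>u \<in> V; x \<noteq> y\<rbrakk> \<Longrightarrow> d x y \<sqinter> c x (d x y \<sqinter> u) \<sqsubseteq> u"
    and domain_finite: "\<lbrakk>u \<in> V; u \<noteq> \<zero>\<rbrakk> \<Longrightarrow> finite (domain u)"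
    and domain_eq: "u \<in> V \<Longrightarrow> domain u = {x. u \<sqsubseteq> d x x}"
    and domain_empty: "\<lbrakk>u \<in> V; domain u = {}\<rbrakk> \<Longrightarrow> u = \<one>"
    and d_refl_nonzero: "d x x \<noteq> \<zero>"
    and d_commute: "d x y = d y x"

end

theory Submission
  imports Defs
begin

text \<open>
  Representability is obtained from a Henkin construction in which variables serve as constants. Fix
  finitely many ``formula'' variables \<open>xs\<close> and use the remaining variables as constants. A decreasing
  sequence of nonzero elements free of \<open>xs\<close>, to which witnesses with fresh constants are added step
  by step, is the diagram of a structure on the set of constants: an assignment \<open>t\<close> of constants to
  \<open>xs\<close> satisfies \<open>w\<close> if some member of the sequence lies below the result of substituting \<open>t\<close> into
  \<open>w\<close>. As formula variables and constants are disjoint, this substitution is a single cylindrification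
  of a meet with diagonals, and no general calculus of substitutions is needed.

  A countable structure can only serve countably many existential statements, over finitely many
  variables, while the algebra may be uncountable. Hence one takes a family of such structures, one for
  each finite set of elements and variables, and forms their reduced product along the filter of
  supersets. Conjunction, existential quantification and equality are preserved by reduced products, so
  that all elements are interpreted correctly at the same time.
\<close>

context projectional_semilattice
begin

subsection \<open>The semilattice and its cylindrifications\<close>

lemmas closed [simp] = meet_closed zero_closed one_closed c_closed d_closed

lemma meet_left_commute:
  "\<lbrakk>u \<in> V; v \<in> V; w \<in> V\<rbrakk> \<Longrightarrow> u \<sqinter> (v \<sqinter> w) = v \<sqinter> (u \<sqinter> w)"
  by (metis meet_assoc meet_commute)

lemmas meet_ac = meet_assoc meet_commute meet_left_commute

lemma le_refl [simp]: "u \<in> V \<Longrightarrow> u \<sqsubseteq> u"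
  by (simp add: le_def meet_idem)

lemma le_trans: "\<lbrakk>u \<sqsubseteq> v; v \<sqsubseteq> w; u \<in> V; v \<in> V; w \<in> V\<rbrakk> \<Longrightarrow> u \<sqsubseteq> w"
  unfolding le_def by (metis meet_assoc)

lemma le_antisym: "\<lbrakk>u \<sqsubseteq> v; v \<sqsubseteq> u; u \<in> V; v \<in> V\<rbrakk> \<Longrightarrow> u = v"
  unfolding le_def by (metis meet_commute)

lemma meet_le1: "\<lbrakk>u \<in> V; v \<in> V\<rbrakk> \<Longrightarrow> u \<sqinter> v \<sqsubseteq> u"
  unfolding le_def by (metis meet_assoc meet_commute meet_idem)

lemma meet_le2: "\<lbrakk>u \<in> V; v \<in> V\<rbrakk> \<Longrightarrow> u \<sqinter> v \<sqsubseteq> v"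
  by (metis meet_commute meet_le1)

lemma le_meet_iff: "\<lbrakk>w \<in> V; u \<in> V; v \<in> V\<rbrakk> \<Longrightarrow> w \<sqsubseteq> u \<sqinter> v \<longleftrightarrow> w \<sqsubseteq> u \<and> w \<sqsubseteq> v"
  using le_trans meet_le1 meet_le2 unfolding le_def by (metis meet_assoc meet_closed)

lemma meet_le_left: "\<lbrakk>u \<sqsubseteq> w; u \<in> V; v \<in> V; w \<in> V\<rbrakk> \<Longrightarrow> u \<sqinter> v \<sqsubseteq> w"
  using le_trans meet_le1 meet_closed by blast

lemma meet_le_right: "\<lbrakk>v \<sqsubseteq> w; u \<in> V; v \<in> V; w \<in> V\<rbrakk> \<Longrightarrow> u \<sqinter> v \<sqsubseteq> w"
  using le_trans meet_le2 meet_closed by blast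

lemma meet_mono:
  "\<lbrakk>u \<sqsubseteq> u'; v \<sqsubseteq> v'; u \<in> V; u' \<in> V; v \<in> V; v' \<in> V\<rbrakk> \<Longrightarrow> u \<sqinter> v \<sqsubseteq> u' \<sqinter> v'"
  by (simp add: le_meet_iff meet_le_left meet_le_right)

lemma meet_absorb: "\<lbrakk>u \<sqsubseteq> v; u \<in> V; v \<in> V\<rbrakk> \<Longrightarrow> u \<sqinter> v = u"
  by (simp add: le_def)

lemma meet_one [simp]: "u \<in> V \<Longrightarrow> u \<sqinter> \<one> = u" "u \<in> V \<Longrightarrow> \<one> \<sqinter> u = u"
  using one_greatest meet_commute unfolding le_def by (metis one_closed)+

lemma le_zero_iff: "u \<in> V \<Longrightarrow> u \<sqsubseteq> \<zero> \<longleftrightarrow> u = \<zero>"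
  using le_antisym zero_least by auto

lemma meet_zero [simp]: "u \<in> V \<Longrightarrow> \<zero> \<sqinter> u = \<zero>" "u \<in> V \<Longrightarrow> u \<sqinter> \<zero> = \<zero>"
  by (simp_all add: le_zero_iff[symmetric] meet_le1 meet_le2)

lemma one_neq_zero: "\<one> \<noteq> \<zero>"
  by (metis d_closed d_refl_nonzero le_zero_iff one_greatest)

lemma c_one [simp]: "c x \<one> = \<one>"
  by (metis c_closed c_increasing le_antisym one_closed one_greatest)

lemma c_idem [simp]: "u \<in> V \<Longrightarrow> c x (c x u) = c x u"
  using c_meet_c[of \<one> u x] by simp

lemma c_mono: "\<lbrakk>u \<sqsubseteq> v; u \<in> V; v \<in> V\<rbrakk> \<Longrightarrow> c x u \<sqsubseteq> c x v"
proof -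
  assume uv: "u \<sqsubseteq> v" "u \<in> V" "v \<in> V"
  have "u \<sqsubseteq> c x v"
    using uv le_trans[OF uv(1) c_increasing] by simp
  hence "c x u = c x (u \<sqinter> c x v)"
    using uv by (simp add: meet_absorb)
  also have "\<dots> = c x u \<sqinter> c x v"
    using uv by (simp add: c_meet_c)
  finally show ?thesis
    by (simp add: le_def)
qed

lemma c_meet_free: "\<lbrakk>c x v = v; u \<in> V; v \<in> V\<rbrakk> \<Longrightarrow> c x (u \<sqinter> v) = c x u \<sqinter> v"
  using c_meet_c[of u v x] by simp

lemma c_meet_free': "\<lbrakk>c x v = v; u \<in> V; v \<in> V\<rbrakk> \<Longrightarrow> c x (v \<sqinter> u) = v \<sqinter> c x u"
  using c_meet_free[of x v u] by (simp add: meet_commute)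

lemma c_d_free: "\<lbrakk>x \<noteq> y; x \<noteq> z\<rbrakk> \<Longrightarrow> c x (d y z) = d y z"
  by (metis c_idem closed(5) d_eq_c_meet meet_closed)

lemma c_neq_zero: "\<lbrakk>u \<in> V; u \<noteq> \<zero>\<rbrakk> \<Longrightarrow> c x u \<noteq> \<zero>"
  using c_increasing le_zero_iff by metis

section \<open>The domain as the set of variables on which an element depends\<close>

lemma mem_domain_iff: "\<lbrakk>u \<in> V; u \<noteq> \<zero>\<rbrakk> \<Longrightarrow> x \<in> domain u \<longleftrightarrow> c x u \<noteq> u"
  using c_noteq_iff[of u x] by (auto simp: domain_eq)

lemma c_not_mem_domain: "\<lbrakk>u \<in> V; x \<notin> domain u\<rbrakk> \<Longrightarrow> c x u = u"
  using mem_domain_iff c_zero by metis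

lemma finite_c_neq: "u \<in> V \<Longrightarrow> finite {x. c x u \<noteq> u}"
  by (cases "u = \<zero>") (auto simp: c_zero domain_finite mem_domain_iff[symmetric])

lemma domain_zero: "domain \<zero> = UNIV"
  by (simp add: domain_eq zero_least)

lemma domain_one: "domain \<one> = {}"
  using mem_domain_iff[of \<one>] one_neq_zero by auto

text \<open>A variable \<open>y\<close> other than \<open>x\<close> stays in the domain because the
  bound \<open>u \<sqsubseteq> d y y\<close> survives \<open>c x\<close>, the diagonal
  \<open>d y y\<close> being free of \<open>x\<close>. No variable enters, because cylindrifications
  commute.\<close>

lemma domain_c: "\<lbrakk>u \<in> V; u \<noteq> \<zero>\<rbrakk> \<Longrightarrow> domain (c x u) = domain u - {x}"
proof (intro set_eqI)
  fix y assume u: "u \<in> V" "u \<noteq> \<zero>"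
  have "c y (c x u) \<noteq> c x u \<longleftrightarrow> y \<noteq> x \<and> c y u \<noteq> u"
  proof (intro iffI)
    assume "c y (c x u) \<noteq> c x u"
    then show "y \<noteq> x \<and> c y u \<noteq> u" using u c_commute by (metis c_idem)
  next
    assume y: "y \<noteq> x \<and> c y u \<noteq> u"
    hence "u \<sqsubseteq> d y y" using u c_noteq_iff by metis
    hence "c x u \<sqsubseteq> d y y"
      using u y c_mono[of u "d y y" x] c_d_free[of x y y] by force
    then show "c y (c x u) \<noteq> c x u" using u c_noteq_iff c_neq_zero by (metis c_closed)
  qed
  then show "y \<in> domain (c x u) \<longleftrightarrow> y \<in> domain u - {x}"
    using u by (simp add: mem_domain_iff c_neq_zero conj_commute)
qed

text \<open>Freeness of \<open>z\<close> passes from both factors to the meet, and a bound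
  \<open>d z z\<close> of one factor also bounds the meet. A zero meet has to be excluded, since
  \<open>domain \<zero>\<close> consists of all variables.\<close>

lemma domain_meet:
  assumes "u \<in> V" "v \<in> V" "u \<sqinter> v \<noteq> \<zero>"
  shows "domain (u \<sqinter> v) = domain u \<union> domain v"
proof
  show "domain (u \<sqinter> v) \<subseteq> domain u \<union> domain v"
    using assms c_meet_free c_not_mem_domain by (fastforce simp: mem_domain_iff)
  show "domain u \<union> domain v \<subseteq> domain (u \<sqinter> v)"
    using assms by (auto simp: domain_eq meet_le_left meet_le_right)
qed

text \<open>No variable is left in the domain, and \<open>domain_empty\<close> then forces the
  element to be \<open>\<one>\<close>.\<close>

lemma c_d_refl [simp]: "c x (d x x) = \<one>"
proof -
  have "domain (c x (d x x)) = {}"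
    using d_refl_nonzero[of x] c_d_free[of _ x x] by (auto simp: domain_c mem_domain_iff) metis
  then show ?thesis by (simp add: domain_empty)
qed

lemma c_d_left: "x \<noteq> y \<Longrightarrow> c x (d x y) = d y y"
  using d_eq_c_meet[of x y y] by (simp add: d_commute[of y x] meet_idem)

lemma c_d_right: "x \<noteq> y \<Longrightarrow> c y (d x y) = d x x"
  using c_d_left[of y x] by (simp add: d_commute)

lemma d_nonzero: "d x y \<noteq> \<zero>"
  by (metis c_d_left c_zero d_refl_nonzero)

lemma d_le_refl: "d x y \<sqsubseteq> d x x" "d x y \<sqsubseteq> d y y"
proof -
  show "d x y \<sqsubseteq> d x x" for x y
    using c_increasing[of "d x y" y] c_d_right by (cases "x = y") auto
  from this[of y x] show "d x y \<sqsubseteq> d y y" by (simp add: d_commute)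
qed

text \<open>If \<open>y\<close> differs from \<open>x\<close> and \<open>z\<close>, then
  \<open>d x z\<close> is the cylindrification in \<open>y\<close> of this very meet.\<close>

lemma d_trans: "d x y \<sqinter> d y z \<sqsubseteq> d x z"
proof (cases "y = x \<or> y = z")
  case True
  then show ?thesis by (auto simp: meet_le1 meet_le2)
next
  case False
  then show ?thesis using d_eq_c_meet[of y x z] c_increasing by (metis d_closed meet_closed)
qed

lemma le_d_trans: "\<lbrakk>u \<sqsubseteq> d x y; u \<sqsubseteq> d y z; u \<in> V\<rbrakk> \<Longrightarrow> u \<sqsubseteq> d x z"
  using d_trans le_meet_iff le_trans by (meson d_closed meet_closed)

lemma domain_d: "domain (d x y) = {x, y}"
  using d_le_refl[of x y] by (auto simp: domain_eq) (metis c_d_free c_noteq_iff d_closed d_nonzero)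

text \<open>If \<open>w\<close> depends on \<open>x\<close>, it already lies below
  \<open>d x x\<close>. Otherwise \<open>w\<close> can be pulled out of \<open>c x\<close>, which
  leaves \<open>c x (d x x) = \<one>\<close>.\<close>

lemma c_d_refl_meet: "w \<in> V \<Longrightarrow> c x (d x x \<sqinter> w) = c x w"
  using c_noteq_iff[of w x] c_zero[of x] c_meet_free[of x w "d x x"]
  by (metis c_d_refl d_closed meet_absorb meet_commute meet_one(2))

subsection \<open>Diagonals and renaming of variables\<close>

text \<open>
  If \<open>t\<close> maps the variables \<open>xs\<close> outside of \<open>xs\<close>, then the result of substituting \<open>t\<close> into \<open>u\<close> is
  \<open>cyl xs (diag xs t \<sqinter> u)\<close>, and \<open>a \<sqinter> diag xs t \<sqsubseteq> u\<close> says that \<open>a\<close> implies this.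
\<close>

definition diag :: "'x list \<Rightarrow> ('x \<Rightarrow> 'x) \<Rightarrow> 'v" where
  "diag xs t = foldr (\<lambda>x e. d x (t x) \<sqinter> e) xs \<one>"

definition cyl :: "'x list \<Rightarrow> 'v \<Rightarrow> 'v" where
  "cyl xs u = foldr c xs u"

lemma diag_Nil [simp]: "diag [] t = \<one>"
  and diag_Cons [simp]: "diag (x # xs) t = d x (t x) \<sqinter> diag xs t"
  and cyl_Nil [simp]: "cyl [] u = u"
  and cyl_Cons [simp]: "cyl (x # xs) u = c x (cyl xs u)"
  by (simp_all add: diag_def cyl_def)

lemma diag_closed [simp]: "diag xs t \<in> V"
  by (induction xs) auto

lemma cyl_closed [simp]: "u \<in> V \<Longrightarrow> cyl xs u \<in> V"
  by (induction xs) auto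

lemma le_diag_iff: "a \<in> V \<Longrightarrow> a \<sqsubseteq> diag xs t \<longleftrightarrow> (\<forall>x\<in>set xs. a \<sqsubseteq> d x (t x))"
  by (induction xs) (auto simp: one_greatest le_meet_iff)

lemma diag_le: "x \<in> set xs \<Longrightarrow> diag xs t \<sqsubseteq> d x (t x)"
  using le_diag_iff[of "diag xs t" xs t] by simp

lemma diag_cong: "(\<And>x. x \<in> set xs \<Longrightarrow> t x = t' x) \<Longrightarrow> diag xs t = diag xs t'"
  by (induction xs) auto

lemma diag_removeAll:
  "x \<in> set xs \<Longrightarrow> diag xs t = d x (t x) \<sqinter> diag (removeAll x xs) t"
proof (intro le_antisym)
  assume x: "x \<in> set xs"
  show "diag xs t \<sqsubseteq> d x (t x) \<sqinter> diag (removeAll x xs) t"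
    using x by (simp add: le_diag_iff le_meet_iff diag_le)
  have "d x (t x) \<sqinter> diag (removeAll x xs) t \<sqsubseteq> d y (t y)" if "y \<in> set xs" for y
    using that meet_le1 meet_le_right[OF diag_le[of y "removeAll x xs" t]] by (cases "y = x") auto
  then show "d x (t x) \<sqinter> diag (removeAll x xs) t \<sqsubseteq> diag xs t"
    by (simp add: le_diag_iff)
qed simp_all

lemma diag_free: "z \<notin> set xs \<Longrightarrow> z \<notin> t ` set xs \<Longrightarrow> c z (diag xs t) = diag xs t"
  by (induction xs) (auto simp: c_meet_free c_d_free)

lemma c_cyl: "u \<in> V \<Longrightarrow> c z (cyl xs u) = cyl xs (c z u)"
proof (induction xs)
  case (Cons x xs)
  then show ?case using c_commute[of "cyl xs u" z x] by simp
qed simp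

lemma cyl_free: "u \<in> V \<Longrightarrow> x \<in> set xs \<Longrightarrow> c x (cyl xs u) = cyl xs u"
proof (induction xs)
  case (Cons y xs)
  then show ?case using c_commute[of "cyl xs u" x y] by auto
qed simp

lemma cyl_increasing: "u \<in> V \<Longrightarrow> u \<sqsubseteq> cyl xs u"
proof (induction xs)
  case (Cons x xs)
  then show ?case using le_trans[of u "cyl xs u" "c x (cyl xs u)"] by (simp add: c_increasing)
qed simp

lemma cyl_mono: "u \<sqsubseteq> v \<Longrightarrow> u \<in> V \<Longrightarrow> v \<in> V \<Longrightarrow> cyl xs u \<sqsubseteq> cyl xs v"
  by (induction xs) (auto intro: c_mono)

lemma cyl_meet_free:
  "(\<And>x. x \<in> set xs \<Longrightarrow> c x v = v) \<Longrightarrow> u \<in> V \<Longrightarrow> v \<in> V \<Longrightarrow> cyl xs (v \<sqinter> u) = v \<sqinter> cyl xs u"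
  by (induction xs) (auto simp: c_meet_free')

text \<open>This is \<open>d_meet_c_le\<close> for several variables at once: substituting
  \<open>t\<close> and meeting with the same diagonals leads back below \<open>u\<close>. In the
  induction \<open>d x (t x)\<close> is free of the remaining variables, so it can be moved out of
  their cylindrification.\<close>

lemma diag_meet_cyl_le:
  assumes "distinct xs" "\<And>x. x \<in> set xs \<Longrightarrow> t x \<notin> set xs" "u \<in> V"
  shows "diag xs t \<sqinter> cyl xs (diag xs t \<sqinter> u) \<sqsubseteq> u"
  using assms
proof (induction xs)
  case Nil
  then show ?case by simp
next
  case (Cons x xs)
  let ?D = "diag xs t" and ?e = "d x (t x)"
  have ne: "x \<noteq> t x" "\<And>y. y \<in> set xs \<Longrightarrow> y \<noteq> x \<and> y \<noteq> t x"
    using Cons.prems by (metis distinct.simps(2) list.set_intros)+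
  have "cyl xs (?e \<sqinter> (?D \<sqinter> u)) = ?e \<sqinter> cyl xs (?D \<sqinter> u)"
    using Cons.prems by (intro cyl_meet_free c_d_free) auto
  moreover have "?e \<sqinter> c x (?e \<sqinter> cyl xs (?D \<sqinter> u)) \<sqsubseteq> cyl xs (?D \<sqinter> u)"
    using Cons.prems ne by (intro d_meet_c_le) auto
  moreover have "?D \<sqinter> cyl xs (?D \<sqinter> u) \<sqsubseteq> u"
    using Cons by auto
  ultimately have "?D \<sqinter> (?e \<sqinter> c x (cyl xs (?e \<sqinter> (?D \<sqinter> u)))) \<sqsubseteq> u"
    using Cons.prems le_trans[OF meet_mono[OF le_refl[of ?D]]] by simp
  then show ?case
    using Cons.prems by (simp add: meet_assoc meet_left_commute)
qed

text \<open>Values for \<open>xs\<close> equal to the constants \<open>t\<close> exist as soon as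
  these constants do: \<open>c x (d x (t x))\<close> is \<open>d (t x) (t x)\<close>, and
  \<open>u\<close> lies below it.\<close>

lemma le_cyl_meet_diag:
  assumes "distinct xs" "\<And>x. x \<in> set xs \<Longrightarrow> t x \<notin> set xs" "u \<in> V"
    and "\<And>x. x \<in> set xs \<Longrightarrow> c x u = u" "\<And>x. x \<in> set xs \<Longrightarrow> u \<sqsubseteq> d (t x) (t x)"
  shows "u \<sqsubseteq> cyl xs (u \<sqinter> diag xs t)"
  using assms
proof (induction xs)
  case Nil
  then show ?case by simp
next
  case (Cons x xs)
  let ?D = "diag xs t" and ?e = "d x (t x)"
  have ne: "x \<noteq> t x"
    using Cons.prems by (metis list.set_intros(1))
  have "u = c x (?e \<sqinter> u)"
    using Cons.prems ne by (subst c_meet_free) (auto simp: c_d_left meet_absorb meet_commute[of "d _ _" u])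
  also have "\<dots> \<sqsubseteq> c x (?e \<sqinter> cyl xs (u \<sqinter> ?D))"
    using Cons by (intro c_mono meet_mono) auto
  also have "?e \<sqinter> cyl xs (u \<sqinter> ?D) = cyl xs (?e \<sqinter> (u \<sqinter> ?D))"
    using Cons.prems by (intro cyl_meet_free[symmetric] c_d_free) auto
  finally show ?case
    using Cons.prems by (simp add: meet_left_commute)
qed

lemma meet_diag_le_filter:
  assumes "a \<sqinter> diag xs t \<sqsubseteq> w" "a \<in> V" "w \<in> V" "\<And>x. x \<in> set xs \<Longrightarrow> t x \<notin> set xs" "distinct xs"
    and "\<And>x. x \<in> set xs \<Longrightarrow> a \<sqsubseteq> d (t x) (t x)"
    and "\<And>x. x \<in> set xs \<Longrightarrow> \<not> P x \<Longrightarrow> c x a = a \<and> c x w = w"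
  shows "a \<sqinter> diag (filter P xs) t \<sqsubseteq> w"
  using assms
proof (induction xs arbitrary: a)
  case Nil
  then show ?case by simp
next
  case (Cons x xs)
  let ?D = "diag xs t" and ?e = "d x (t x)"
  have le: "(a \<sqinter> ?e) \<sqinter> ?D \<sqsubseteq> w"
    using Cons.prems by (simp add: meet_assoc)
  show ?case
  proof (cases "P x")
    case True
    have "(a \<sqinter> ?e) \<sqinter> diag (filter P xs) t \<sqsubseteq> w"
    proof (rule Cons.IH[OF le])
      fix y assume y: "y \<in> set xs"
      then show "a \<sqinter> ?e \<sqsubseteq> d (t y) (t y)" using Cons.prems by (simp add: meet_le_left)
      assume "\<not> P y"
      then show "c y (a \<sqinter> ?e) = a \<sqinter> ?e \<and> c y w = w"
        using Cons.prems y c_meet_free'[of y a ?e] c_d_free[of y x "t x"]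
        by (metis d_closed distinct.simps(2) list.set_intros)
    qed (use Cons.prems in auto)
    with True Cons.prems show ?thesis by (simp add: meet_assoc)
  next
    case False
    have ne: "x \<noteq> t x"
      using Cons.prems by (metis list.set_intros(1))
    \<comment> \<open>The factor \<open>c x ?e\<close> is \<open>d (t x) (t x)\<close>, which lies
      above \<open>a\<close>. Adding it turns the left-hand side into a cylindrification in
      \<open>x\<close> of the assumed meet.\<close>
    have "a \<sqinter> ?D = (a \<sqinter> ?D) \<sqinter> c x ?e"
      using Cons.prems ne by (simp add: c_d_left meet_absorb meet_le_left)
    also have "\<dots> = c x (a \<sqinter> ?D \<sqinter> ?e)"
    proof (intro c_meet_free'[symmetric])
      have "c x ?D = ?D"
        using Cons.prems(4,5) by (intro diag_free) auto
      then show "c x (a \<sqinter> ?D) = a \<sqinter> ?D"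
        using Cons.prems False by (simp add: c_meet_free)
    qed (use Cons.prems in auto)
    also have "\<dots> = c x ((a \<sqinter> ?e) \<sqinter> ?D)"
      using Cons.prems by (simp add: meet_ac)
    also have "\<dots> \<sqsubseteq> w"
      using c_mono[OF le, of x] Cons.prems False by simp
    finally show ?thesis
      using False Cons.prems by (simp add: Cons.IH)
  qed
qed

text \<open>
  The witness \<open>b\<close> is the result of substituting \<open>t(x := k)\<close> into \<open>w\<close>; by \<open>a \<sqsubseteq> c k b\<close>, meeting \<open>a\<close>
  with it is conservative.
\<close>

lemma henkin_witness:
  assumes xs: "distinct xs" "\<And>z. z \<in> set xs \<Longrightarrow> t z \<notin> set xs" "x \<in> set xs"
    and a: "a \<in> V" "\<And>z. z \<in> set xs \<Longrightarrow> c z a = a" "\<And>z. z \<in> set xs \<Longrightarrow> a \<sqsubseteq> d (t z) (t z)"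
    and k: "k \<notin> set xs" "k \<notin> t ` set xs"
    and w: "w \<in> V" "c k w = w"
    and le: "a \<sqinter> diag xs t \<sqsubseteq> c x w"
  obtains b where "b \<in> V" "\<And>z. z \<in> set xs \<Longrightarrow> c z b = b" "a \<sqsubseteq> c k b"
    "b \<sqinter> diag xs (t(x := k)) \<sqsubseteq> w"
proof
  define ys where "ys = removeAll x xs"
  have ys: "distinct ys" "set xs = insert x (set ys)" "x \<notin> set ys"
    using xs by (auto simp: ys_def distinct_removeAll)
  let ?D = "diag ys t"
  define b where "b = cyl ys (?D \<sqinter> c x (d x k \<sqinter> w))"
  have "diag ys (t(x := k)) = ?D"
    using ys(3) by (intro diag_cong) auto
  then have tk: "diag xs (t(x := k)) = d x k \<sqinter> ?D"
    using diag_removeAll[OF xs(3), of "t(x := k)"] by (simp add: ys_def)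
  have Dx: "c x ?D = ?D" and Dk: "c k ?D = ?D"
    using xs(2,3) ys(2,3) k by (auto intro!: diag_free)
  show "b \<in> V" using w by (simp add: b_def)
  show "c z b = b" if "z \<in> set xs" for z
  proof (cases "z = x")
    case True
    then show ?thesis using w Dx by (simp add: b_def c_cyl c_meet_free)
  next
    case False
    then show ?thesis using that ys w by (simp add: b_def cyl_free)
  qed
  \<comment> \<open>The constant \<open>k\<close> enters \<open>b\<close> only through
    \<open>d x k\<close>. Cylindrifying it leaves \<open>d x x\<close>, which \<open>c x\<close>
    absorbs.\<close>
  have "c k b = cyl ys (?D \<sqinter> c x (c k (d x k \<sqinter> w)))"
    using w Dk by (simp add: b_def c_cyl c_meet_free' c_commute[of "d x k \<sqinter> w" k x])
  also have "c k (d x k \<sqinter> w) = d x x \<sqinter> w"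
    using w k(1) xs(3) c_d_right[of x k] by (subst c_meet_free) force+
  also have "c x \<dots> = c x w"
    using w by (rule_tac c_d_refl_meet)
  finally have ckb: "c k b = cyl ys (?D \<sqinter> c x w)" .
  have "a \<sqinter> ?D \<sqsubseteq> c x w"
    using meet_diag_le_filter[OF le, of "\<lambda>z. z \<noteq> x"] a xs w
    by (simp add: ys_def removeAll_filter_not_eq neq_commute)
  hence "a \<sqinter> ?D \<sqsubseteq> ?D \<sqinter> c x w"
    using a w by (simp add: le_meet_iff meet_le2)
  hence "cyl ys (a \<sqinter> ?D) \<sqsubseteq> c k b"
    unfolding ckb using a w by (intro cyl_mono) auto
  moreover have "a \<sqsubseteq> cyl ys (a \<sqinter> ?D)"
    using xs ys a by (intro le_cyl_meet_diag) auto
  ultimately show "a \<sqsubseteq> c k b"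
    using a w le_trans[of a "cyl ys (a \<sqinter> ?D)" "c k b"] by (simp add: b_def)
  have "?D \<sqinter> b \<sqsubseteq> c x (d x k \<sqinter> w)"
    unfolding b_def using xs ys w by (intro diag_meet_cyl_le) auto
  hence "d x k \<sqinter> (?D \<sqinter> b) \<sqsubseteq> d x k \<sqinter> c x (d x k \<sqinter> w)"
    using w by (intro meet_mono) (auto simp: b_def)
  moreover have "d x k \<sqinter> c x (d x k \<sqinter> w) \<sqsubseteq> w"
    using w k xs by (intro d_meet_c_le) auto
  ultimately have "d x k \<sqinter> (?D \<sqinter> b) \<sqsubseteq> w"
    using w \<open>b \<in> V\<close> le_trans by (meson closed diag_closed)
  then show "b \<sqinter> diag xs (t(x := k)) \<sqsubseteq> w"
    using \<open>b \<in> V\<close> unfolding tk by (simp add: meet_ac)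
qed

subsection \<open>Henkin chains\<close>

definition avoids :: "('x \<Rightarrow> 'x) \<Rightarrow> 'x list \<Rightarrow> bool" where
  "avoids t xs \<longleftrightarrow> (\<forall>x\<in>set xs. t x \<notin> set xs)"

text \<open>The elements of the described structure are named by the variables outside
  \<open>xs\<close>. As \<open>d k k\<close> differs from \<open>\<one>\<close>, the chain must
  explicitly assert that \<open>k\<close> denotes something. The last clause is the Henkin property,
  restricted to \<open>W\<close> so that countably many stages can achieve it.\<close>

definition henkin_chain :: "'x list \<Rightarrow> 'v set \<Rightarrow> (nat \<Rightarrow> 'v) \<Rightarrow> bool" where
  "henkin_chain xs W a \<longleftrightarrow> distinct xs \<and>
     (\<forall>n. a n \<in> V \<and> a n \<noteq> \<zero> \<and> (\<forall>x\<in>set xs. c x (a n) = a n) \<and> a (Suc n) \<sqsubseteq> a n) \<and>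
     (\<forall>k. k \<notin> set xs \<longrightarrow> (\<exists>n. a n \<sqsubseteq> d k k)) \<and>
     (\<forall>w\<in>W. \<forall>x\<in>set xs. \<forall>t n. avoids t xs \<longrightarrow> a n \<sqinter> diag xs t \<sqsubseteq> c x w \<longrightarrow>
       (\<exists>m k. k \<notin> set xs \<and> a m \<sqinter> diag xs (t(x := k)) \<sqsubseteq> w))"

text \<open>Invariant of the construction: the information \<open>a\<close> gathered so far does not
  imply \<open>v\<close> at the assignment \<open>t\<close>. In particular it is consistent.\<close>

definition refutes :: "'x list \<Rightarrow> ('x \<Rightarrow> 'x) \<Rightarrow> 'v \<Rightarrow> 'v \<Rightarrow> bool" where
  "refutes xs t v a \<longleftrightarrow>
     a \<in> V \<and> (\<forall>x\<in>set xs. c x a = a) \<and> \<not> a \<sqinter> diag xs t \<sqsubseteq> v"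

lemma refutes_nonzero: "refutes xs t v a \<Longrightarrow> v \<in> V \<Longrightarrow> a \<noteq> \<zero>"
  by (auto simp: refutes_def zero_least)

text \<open>If \<open>a \<sqinter> b\<close> implied \<open>v\<close>, then cylindrifying the fresh
  constant \<open>k\<close> would replace \<open>b\<close> by \<open>c k b\<close>, which
  \<open>a\<close> implies anyway, so \<open>a\<close> alone would imply \<open>v\<close>.\<close>

lemma refutes_meet:
  assumes a: "refutes xs t v a" and v: "v \<in> V" "c k v = v"
    and k: "k \<notin> set xs" "k \<notin> t ` set xs" "c k a = a"
    and b: "b \<in> V" "\<And>x. x \<in> set xs \<Longrightarrow> c x b = b" "a \<sqsubseteq> c k b"
  shows "refutes xs t v (a \<sqinter> b)"
proof -
  have aV: "a \<in> V" using a by (simp add: refutes_def)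
  have "\<not> (a \<sqinter> b) \<sqinter> diag xs t \<sqsubseteq> v"
  proof
    assume "(a \<sqinter> b) \<sqinter> diag xs t \<sqsubseteq> v"
    then have "c k ((a \<sqinter> b) \<sqinter> diag xs t) \<sqsubseteq> v"
      using c_mono[of "(a \<sqinter> b) \<sqinter> diag xs t" v k] v aV b by simp
    moreover have "c k ((a \<sqinter> b) \<sqinter> diag xs t) = (a \<sqinter> c k b) \<sqinter> diag xs t"
      using k b aV diag_free[of k xs t] by (simp add: c_meet_free c_meet_free')
    ultimately show False
      using a b aV by (simp add: refutes_def meet_absorb)
  qed
  then show ?thesis
    using a b by (auto simp: refutes_def c_meet_free)
qed

text \<open>There are three cases. If \<open>k\<close> is a value of \<open>t\<close>, the diagonals
  already imply \<open>d k k\<close>; if \<open>a\<close> depends on \<open>k\<close>, so does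
  \<open>a\<close>; otherwise \<open>k\<close> is fresh and \<open>c k (d k k) = \<one>\<close>
  makes the addition conservative.\<close>

lemma refutes_meet_d:
  assumes a: "refutes xs t v a" and v: "v \<in> V" "c k v = v" and k: "k \<notin> set xs"
  shows "refutes xs t v (a \<sqinter> d k k)"
proof (cases "k \<in> t ` set xs")
  have dk: "c x (d k k) = d k k" if "x \<in> set xs" for x
    using that k by (intro c_d_free) auto
  case True
  then obtain x where x: "x \<in> set xs" "k = t x" by blast
  have "diag xs t \<sqsubseteq> d k k"
    using x diag_le[of x xs t] d_le_refl(2)[of x k] le_trans[of "diag xs t" "d x k" "d k k"] by simp
  then have "(a \<sqinter> d k k) \<sqinter> diag xs t = a \<sqinter> diag xs t"
    using a meet_absorb[of "diag xs t" "d k k"]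
    by (simp add: refutes_def meet_assoc meet_commute[of "d k k"])
  then show ?thesis
    using a dk by (auto simp: refutes_def c_meet_free)
next
  have dk: "c x (d k k) = d k k" if "x \<in> set xs" for x
    using that k by (intro c_d_free) auto
  case False
  have a': "a \<in> V" "a \<noteq> \<zero>"
    using a v refutes_nonzero by (auto simp: refutes_def)
  show ?thesis
  proof (cases "c k a = a")
    case True
    then show ?thesis
      using False k v a a' dk by (intro refutes_meet) (auto simp: one_greatest)
  next
    case False
    then show ?thesis
      using a a' c_noteq_iff[of a k] by (simp add: meet_absorb)
  qed
qed

lemma refutes_step:
  assumes a: "refutes xs t0 v a" and v: "v \<in> V" "\<And>z. z \<notin> set xs \<Longrightarrow> c z v = v"
    and inf: "infinite (UNIV :: 'x set)"
    and w: "w \<in> V" "\<And>z. z \<notin> set xs \<Longrightarrow> c z w = w"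
    and xs: "distinct xs" "x \<in> set xs" "avoids t xs"
    and le: "a \<sqinter> diag xs t \<sqsubseteq> c x w" "\<And>z. z \<in> set xs \<Longrightarrow> a \<sqsubseteq> d (t z) (t z)"
  obtains a' k where "refutes xs t0 v a'" "a' \<sqsubseteq> a" "k \<notin> set xs"
    "a' \<sqinter> diag xs (t(x := k)) \<sqsubseteq> w"
proof -
  have a': "a \<in> V" "\<And>x. x \<in> set xs \<Longrightarrow> c x a = a"
    using a by (auto simp: refutes_def)
  \<comment> \<open>Elements depend on finitely many variables only, so some constant is fresh for
    \<open>a\<close> and for both assignments.\<close>
  have "finite ({z. c z a \<noteq> a} \<union> set xs \<union> t ` set xs \<union> t0 ` set xs)"
    using a' by (simp add: finite_c_neq)
  from ex_new_if_finite[OF inf this]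
  obtain k where k: "c k a = a" "k \<notin> set xs" "k \<notin> t ` set xs" "k \<notin> t0 ` set xs"
    by blast
  obtain b where b: "b \<in> V" "\<And>z. z \<in> set xs \<Longrightarrow> c z b = b" "a \<sqsubseteq> c k b"
    "b \<sqinter> diag xs (t(x := k)) \<sqsubseteq> w"
    using henkin_witness[of xs t x a k w] xs a' le w k by (auto simp: avoids_def)
  show ?thesis
  proof
    show "refutes xs t0 v (a \<sqinter> b)"
      using a v k b by (intro refutes_meet) auto
    show "a \<sqinter> b \<sqsubseteq> a" using a' b by (simp add: meet_le1)
    show "(a \<sqinter> b) \<sqinter> diag xs (t(x := k)) \<sqsubseteq> w"
      using a' b w by (simp add: meet_assoc meet_le_right)
  qed (fact k)
qed

section \<open>Construction of Henkin chains by dependent choice\<close>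

lemma chain_antimono:
  assumes "\<And>n. a n \<in> V" "\<And>n. a (Suc n) \<sqsubseteq> a n" "m \<le> n"
  shows "a n \<sqsubseteq> a m"
  using assms(3)
proof (induction n rule: dec_induct)
  case (step n)
  then show ?case using assms le_trans by blast
qed (use assms in simp)

lemma chain_finite_le:
  assumes "\<And>n. a n \<in> V" "\<And>n. a (Suc n) \<sqsubseteq> a n" "finite Z"
    and "\<And>z. z \<in> Z \<Longrightarrow> \<exists>n. a n \<sqsubseteq> f z" "\<And>z. z \<in> Z \<Longrightarrow> f z \<in> V"
  shows "\<exists>n\<ge>m. \<forall>z\<in>Z. \<forall>n'\<ge>n. a n' \<sqsubseteq> f z"
proof -
  obtain g where g: "\<And>z. z \<in> Z \<Longrightarrow> a (g z) \<sqsubseteq> f z"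
    using assms(4) by metis
  define n where "n = Max (insert m (g ` Z))"
  show ?thesis
  proof (intro exI[of _ n] conjI ballI allI impI)
    show "m \<le> n" using assms(3) by (simp add: n_def)
    fix z n' assume z: "z \<in> Z" "n' \<ge> n"
    have "g z \<le> n" using z assms(3) by (simp add: n_def)
    then show "a n' \<sqsubseteq> f z"
      using z g assms chain_antimono[of a "g z" n'] le_trans by (meson order_trans)
  qed
qed

text \<open>Dependent choice with \<open>refutes\<close> as invariant: stage \<open>n\<close> first
  makes the constant \<open>k n\<close> denote and then adds a witness for the task
  \<open>e n\<close>.\<close>

lemma henkin_chain_exists:
  assumes inf: "infinite (UNIV :: 'x set)" and cnt: "countable (UNIV :: 'x set)"
    and xs: "distinct xs"
    and W: "countable W" "W \<subseteq> V" "\<And>w z. w \<in> W \<Longrightarrow> z \<notin> set xs \<Longrightarrow> c z w = w"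
    and v: "v \<in> V" "\<And>z. z \<notin> set xs \<Longrightarrow> c z v = v"
    and a0: "refutes xs t0 v a0"
  obtains a where "henkin_chain xs W a" "\<And>n. a n \<sqsubseteq> a0" "\<And>n. \<not> a n \<sqinter> diag xs t0 \<sqsubseteq> v"
proof -
  \<comment> \<open>Only the values on \<open>xs\<close> matter, so it suffices to consider the
    countably many assignments read off from lists of values.\<close>
  define F where "F = {t. avoids t xs} \<inter> (\<lambda>ys. the \<circ> map_of (zip xs ys)) ` lists UNIV"
  define T where "T = W \<times> set xs \<times> F"
  have "countable F"
    unfolding F_def using cnt by (intro countable_Int2 countable_image countable_lists)
  then have "countable T"
    unfolding T_def using W by (intro countable_SIGMA) (auto intro: countable_finite)
  \<comment> \<open>Through the pairing every task recurs arbitrarily late. This is needed because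
    the premise of a task may become true only at a late stage.\<close>
  define e where "e n = from_nat_into T (fst (prod_decode n))" for n
  have e: "\<exists>m\<ge>n. e m = \<tau>" if \<tau>: "\<tau> \<in> T" for \<tau> n
  proof -
    obtain j where "from_nat_into T j = \<tau>"
      using from_nat_into_surj[OF \<open>countable T\<close> \<tau>] by blast
    then have "e (prod_encode (j, n)) = \<tau>" by (simp add: e_def)
    then show ?thesis using le_prod_encode_2 by blast
  qed
  \<comment> \<open>The premises are tested before the stage and the witness is required after it.
    The second premise, that all values of \<open>t\<close> denote, is the one demanded by
    \<open>refutes_step\<close>.\<close>
  define serves where "serves \<tau> a a' \<longleftrightarrow> (case \<tau> of (w, x, t) \<Rightarrow>
      a \<sqinter> diag xs t \<sqsubseteq> c x w \<longrightarrow> (\<forall>z\<in>set xs. a \<sqsubseteq> d (t z) (t z)) \<longrightarrow>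
      (\<exists>k. k \<notin> set xs \<and> a' \<sqinter> diag xs (t(x := k)) \<sqsubseteq> w))" for \<tau> a a'
  define k where "k n = from_nat_into (UNIV :: 'x set) n" for n
  have "\<exists>a. \<forall>n. (refutes xs t0 v (a n) \<and> a n \<sqsubseteq> a0) \<and>
      (a (Suc n) \<sqsubseteq> a n \<and> (k n \<notin> set xs \<longrightarrow> a (Suc n) \<sqsubseteq> d (k n) (k n)) \<and>
       (e n \<in> T \<longrightarrow> serves (e n) (a n) (a (Suc n))))"
  proof (rule dependent_nat_choice)
    show "\<exists>a. refutes xs t0 v a \<and> a \<sqsubseteq> a0"
      using a0 by (auto simp: refutes_def)
  next
    fix a n
    assume a: "refutes xs t0 v a \<and> a \<sqsubseteq> a0"
    have "\<exists>a'. refutes xs t0 v a' \<and> a' \<sqsubseteq> a \<and> (k n \<notin> set xs \<longrightarrow> a' \<sqsubseteq> d (k n) (k n))"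
    proof (cases "k n \<in> set xs")
      case False
      moreover have "a \<in> V" using a by (auto simp: refutes_def)
      ultimately show ?thesis
        using a v refutes_meet_d[of xs t0 v a "k n"] by (metis d_closed meet_le1 meet_le2)
    qed (use a in \<open>auto simp: refutes_def\<close>)
    then obtain a' where a': "refutes xs t0 v a'" "a' \<sqsubseteq> a"
        "k n \<notin> set xs \<longrightarrow> a' \<sqsubseteq> d (k n) (k n)"
      by blast
    have "\<exists>a''. refutes xs t0 v a'' \<and> a'' \<sqsubseteq> a' \<and> (e n \<in> T \<longrightarrow> serves (e n) a a'')"
    proof (cases "e n \<in> T \<and> \<not> serves (e n) a a'")
      case True
      obtain w x t where wxt: "e n = (w, x, t)" by (cases "e n")
      have *: "w \<in> W" "x \<in> set xs" "avoids t xs" "a \<sqinter> diag xs t \<sqsubseteq> c x w"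
        "\<And>z. z \<in> set xs \<Longrightarrow> a \<sqsubseteq> d (t z) (t z)"
        using True wxt by (auto simp: T_def F_def serves_def)
      have V: "a \<in> V" "a' \<in> V" "w \<in> V" using a a' * W by (auto simp: refutes_def)
      have "a' \<sqinter> diag xs t \<sqsubseteq> c x w" "\<And>z. z \<in> set xs \<Longrightarrow> a' \<sqsubseteq> d (t z) (t z)"
        using * V a' le_trans[of a' a]
          le_trans[of "a' \<sqinter> diag xs t" "a \<sqinter> diag xs t" "c x w"] by (auto simp: meet_mono)
      then obtain a'' k where "refutes xs t0 v a''" "a'' \<sqsubseteq> a'" "k \<notin> set xs"
          "a'' \<sqinter> diag xs (t(x := k)) \<sqsubseteq> w"
        using refutes_step[OF a'(1) v inf V(3) _ xs *(2,3)] W(3) *(1) by blast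
      then show ?thesis by (auto simp: wxt serves_def)
    qed (use a' in \<open>auto simp: refutes_def\<close>)
    then obtain a'' where a'': "refutes xs t0 v a''" "a'' \<sqsubseteq> a'" "e n \<in> T \<longrightarrow> serves (e n) a a''"
      by blast
    have V: "a \<in> V" "a' \<in> V" "a'' \<in> V" "a0 \<in> V"
      using a a' a'' a0 by (auto simp: refutes_def)
    have "a'' \<sqsubseteq> a" using V a' a'' le_trans by blast
    moreover have "a'' \<sqsubseteq> a0" using calculation V a le_trans by blast
    moreover have "k n \<notin> set xs \<longrightarrow> a'' \<sqsubseteq> d (k n) (k n)"
      using V a' a'' le_trans d_closed by blast
    ultimately show "\<exists>b. (refutes xs t0 v b \<and> b \<sqsubseteq> a0) \<and> b \<sqsubseteq> a \<and>
        (k n \<notin> set xs \<longrightarrow> b \<sqsubseteq> d (k n) (k n)) \<and> (e n \<in> T \<longrightarrow> serves (e n) a b)"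
      using a'' by blast
  qed
  then obtain a where a: "\<And>n. refutes xs t0 v (a n)" "\<And>n. a n \<sqsubseteq> a0" "\<And>n. a (Suc n) \<sqsubseteq> a n"
      "\<And>n. k n \<notin> set xs \<Longrightarrow> a (Suc n) \<sqsubseteq> d (k n) (k n)"
      "\<And>n. e n \<in> T \<Longrightarrow> serves (e n) (a n) (a (Suc n))"
    by blast
  have aV: "a n \<in> V" for n using a(1) by (simp add: refutes_def)
  have nz: "a n \<noteq> \<zero>" for n
    using a(1)[of n] v(1) refutes_nonzero by blast
  have dd: "\<exists>n. a n \<sqsubseteq> d l l" if "l \<notin> set xs" for l
  proof -
    obtain n where "k n = l"
      using from_nat_into_surj[OF cnt] by (auto simp: k_def)
    then show ?thesis using a(4) that by blast
  qed
  have "\<exists>m k. k \<notin> set xs \<and> a m \<sqinter> diag xs (t(x := k)) \<sqsubseteq> w"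
    if w: "w \<in> W" and x: "x \<in> set xs" and t: "avoids t xs" and le: "a n \<sqinter> diag xs t \<sqsubseteq> c x w"
    for w x t n
  proof -
    \<comment> \<open>This is the representative in \<open>F\<close> of the given assignment; it
      agrees with \<open>t\<close> on \<open>xs\<close>.\<close>
    define t' where "t' = the \<circ> map_of (zip xs (map t xs))"
    have t': "diag xs t' = diag xs t" "\<And>k. diag xs (t'(x := k)) = diag xs (t(x := k))"
      by (auto intro!: diag_cong simp: t'_def map_of_zip_map)
    have "\<exists>n'\<ge>n. \<forall>z\<in>set xs. \<forall>m\<ge>n'. a m \<sqsubseteq> d (t z) (t z)"
      using t dd aV a(3) by (intro chain_finite_le) (auto simp: avoids_def)
    then obtain n' where n': "n \<le> n'" "\<And>z m. z \<in> set xs \<Longrightarrow> n' \<le> m \<Longrightarrow> a m \<sqsubseteq> d (t z) (t z)"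
      by blast
    have "avoids t' xs"
      using t by (simp add: t'_def avoids_def map_of_zip_map)
    then have "(w, x, t') \<in> T"
      using w x by (auto simp: T_def F_def t'_def)
    then obtain m where m: "n' \<le> m" "e m = (w, x, t')" using e by blast
    have "a m \<sqinter> diag xs t' \<sqsubseteq> c x w"
      using chain_antimono[of a n m] aV a(3) n' m le W w
        le_trans[of "a m \<sqinter> diag xs t" "a n \<sqinter> diag xs t" "c x w"] meet_mono t' by auto
    moreover have "\<forall>z\<in>set xs. a m \<sqsubseteq> d (t' z) (t' z)"
      using n' m by (auto simp: t'_def map_of_zip_map)
    ultimately show ?thesis
      using a(5)[of m] \<open>(w, x, t') \<in> T\<close> m t' by (auto simp: serves_def)
  qed
  then have "henkin_chain xs W a"
    using xs a aV nz dd unfolding henkin_chain_def refutes_def by blast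
  with a that show ?thesis by (auto simp: refutes_def)
qed

subsection \<open>Satisfaction in a Henkin chain\<close>

definition sat :: "'x list \<Rightarrow> (nat \<Rightarrow> 'v) \<Rightarrow> 'v \<Rightarrow> ('x \<Rightarrow> 'x) \<Rightarrow> bool" where
  "sat xs a w t \<longleftrightarrow> (\<exists>n. a n \<sqinter> diag xs t \<sqsubseteq> w)"

lemma sat_diag_cong:
  "(\<And>x. x \<in> set xs \<Longrightarrow> t x = t' x) \<Longrightarrow> sat xs a w t \<longleftrightarrow> sat xs a w t'"
  unfolding sat_def using diag_cong[of xs t t'] by simp

definition eqv :: "(nat \<Rightarrow> 'v) \<Rightarrow> 'x \<Rightarrow> 'x \<Rightarrow> bool" where
  "eqv a k l \<longleftrightarrow> (\<exists>n. a n \<sqsubseteq> d k l)"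

context
  fixes xs W a
  assumes H: "henkin_chain xs W a"
begin

lemma chain_closed [simp]: "a n \<in> V"
  and chain_free: "x \<in> set xs \<Longrightarrow> c x (a n) = a n"
  and chain_nonzero: "a n \<noteq> \<zero>"
  and chain_Suc_le: "a (Suc n) \<sqsubseteq> a n"
  and chain_distinct: "distinct xs"
  and eqv_refl: "k \<notin> set xs \<Longrightarrow> eqv a k k"
  using H unfolding henkin_chain_def eqv_def by blast+

lemma chain_mono: "m \<le> n \<Longrightarrow> a n \<sqsubseteq> a m"
  using chain_antimono[of a m n] chain_Suc_le by simp

lemma chain_le_mono: "a m \<sqsubseteq> u \<Longrightarrow> m \<le> n \<Longrightarrow> u \<in> V \<Longrightarrow> a n \<sqsubseteq> u"
  using chain_mono[of m n] le_trans[of "a n" "a m" u] by simp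

lemma chain_meet_diag_mono:
  "a m \<sqinter> diag xs t \<sqsubseteq> u \<Longrightarrow> m \<le> n \<Longrightarrow> u \<in> V \<Longrightarrow> a n \<sqinter> diag xs t \<sqsubseteq> u"
  using le_trans[of "a n \<sqinter> diag xs t" "a m \<sqinter> diag xs t" u] chain_mono[of m n]
  by (simp add: meet_mono)

lemma eqv_sym: "eqv a k l \<Longrightarrow> eqv a l k"
  by (simp add: eqv_def d_commute)

lemma eqv_trans: "eqv a j k \<Longrightarrow> eqv a k l \<Longrightarrow> eqv a j l"
proof -
  assume "eqv a j k" "eqv a k l"
  then obtain m n where mn: "a m \<sqsubseteq> d j k" "a n \<sqsubseteq> d k l" by (auto simp: eqv_def)
  have "a (max m n) \<sqsubseteq> d j k" "a (max m n) \<sqsubseteq> d k l"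
    using chain_le_mono[OF mn(1) max.cobounded1] chain_le_mono[OF mn(2) max.cobounded2] by simp_all
  then have "a (max m n) \<sqsubseteq> d j l" using le_d_trans[of "a (max m n)" j k l] by simp
  then show "eqv a j l" by (auto simp: eqv_def)
qed

lemma avoids_chain_le:
  assumes "avoids t xs"
  shows "\<exists>n\<ge>m. \<forall>z\<in>set xs. a n \<sqsubseteq> d (t z) (t z)"
proof -
  have "\<exists>n. a n \<sqsubseteq> d (t z) (t z)" if "z \<in> set xs" for z
    using that assms eqv_refl[of "t z"] by (auto simp: avoids_def eqv_def)
  then have "\<exists>n\<ge>m. \<forall>z\<in>set xs. \<forall>n'\<ge>n. a n' \<sqsubseteq> d (t z) (t z)"
    using chain_Suc_le by (intro chain_finite_le) auto
  then show ?thesis by blast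
qed

lemma sat_zero:
  assumes t: "avoids t xs"
  shows "\<not> sat xs a \<zero> t"
proof
  assume "sat xs a \<zero> t"
  then obtain m where m: "a m \<sqinter> diag xs t \<sqsubseteq> \<zero>" by (auto simp: sat_def)
  obtain n where n: "m \<le> n" "\<And>z. z \<in> set xs \<Longrightarrow> a n \<sqsubseteq> d (t z) (t z)"
    using avoids_chain_le t by blast
  \<comment> \<open>The constant predicate \<open>False\<close> drops all diagonals, so the nonzero
    element \<open>a n\<close> itself would be zero.\<close>
  have "a n \<sqinter> diag (filter (\<lambda>_. False) xs) t \<sqsubseteq> \<zero>"
    using chain_meet_diag_mono[OF m n(1)] n t chain_distinct chain_free
    by (intro meet_diag_le_filter) (auto simp: avoids_def c_zero)
  then show False
    by (simp add: le_zero_iff chain_nonzero)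
qed

lemma sat_mono: "sat xs a u t \<Longrightarrow> u \<sqsubseteq> v \<Longrightarrow> u \<in> V \<Longrightarrow> v \<in> V \<Longrightarrow> sat xs a v t"
proof -
  assume "sat xs a u t" and uv: "u \<sqsubseteq> v" "u \<in> V" "v \<in> V"
  then obtain n where "a n \<sqinter> diag xs t \<sqsubseteq> u" by (auto simp: sat_def)
  then have "a n \<sqinter> diag xs t \<sqsubseteq> v" using uv le_trans[of _ u v] by simp
  then show "sat xs a v t" by (auto simp: sat_def)
qed

lemma sat_one: "sat xs a \<one> t"
  by (simp add: sat_def one_greatest)

lemma sat_meet:
  assumes "u \<in> V" "v \<in> V"
  shows "sat xs a (u \<sqinter> v) t \<longleftrightarrow> sat xs a u t \<and> sat xs a v t"
proof
  assume "sat xs a u t \<and> sat xs a v t"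
  then obtain m n where mn: "a m \<sqinter> diag xs t \<sqsubseteq> u" "a n \<sqinter> diag xs t \<sqsubseteq> v"
    by (auto simp: sat_def)
  have "a (max m n) \<sqinter> diag xs t \<sqsubseteq> u \<sqinter> v"
    using assms chain_meet_diag_mono[OF mn(1) max.cobounded1]
      chain_meet_diag_mono[OF mn(2) max.cobounded2] by (simp add: le_meet_iff)
  then show "sat xs a (u \<sqinter> v) t" unfolding sat_def by blast
next
  assume "sat xs a (u \<sqinter> v) t"
  then show "sat xs a u t \<and> sat xs a v t"
    using assms sat_mono[of "u \<sqinter> v" t u] sat_mono[of "u \<sqinter> v" t v] by (simp add: meet_le1 meet_le2)
qed

text \<open>Transitivity of diagonals converts \<open>d x y\<close> into
  \<open>d (t x) (t y)\<close> and back. The latter is free of \<open>xs\<close>, so the diagonals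
  of the assignment can then be discarded.\<close>

lemma sat_d:
  assumes t: "avoids t xs" and xy: "x \<in> set xs" "y \<in> set xs"
  shows "sat xs a (d x y) t \<longleftrightarrow> eqv a (t x) (t y)"
proof
  assume "sat xs a (d x y) t"
  then obtain m where m: "a m \<sqinter> diag xs t \<sqsubseteq> d x y" by (auto simp: sat_def)
  obtain n where n: "m \<le> n" "\<And>z. z \<in> set xs \<Longrightarrow> a n \<sqsubseteq> d (t z) (t z)"
    using avoids_chain_le t by blast
  let ?u = "a n \<sqinter> diag xs t"
  have "?u \<sqsubseteq> d x (t x)" "?u \<sqsubseteq> d y (t y)"
    using xy by (auto intro: meet_le_right diag_le)
  moreover have "?u \<sqsubseteq> d x y"
    using chain_meet_diag_mono[OF m n(1)] by simp
  ultimately have "?u \<sqsubseteq> d (t x) (t y)"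
    using le_d_trans[of ?u "t x" x y] le_d_trans[of ?u "t x" y "t y"] d_commute[of x "t x"] by simp
  then have "a n \<sqinter> diag (filter (\<lambda>_. False) xs) t \<sqsubseteq> d (t x) (t y)"
    using n t chain_distinct chain_free xy
    by (intro meet_diag_le_filter) (auto simp: avoids_def intro!: c_d_free)
  then show "eqv a (t x) (t y)" by (auto simp: eqv_def)
next
  assume "eqv a (t x) (t y)"
  then obtain n where n: "a n \<sqsubseteq> d (t x) (t y)" by (auto simp: eqv_def)
  let ?u = "a n \<sqinter> diag xs t"
  have "?u \<sqsubseteq> d x (t x)" "?u \<sqsubseteq> d (t y) y"
    using xy by (auto intro: meet_le_right diag_le simp: d_commute[of "t y"])
  moreover have "?u \<sqsubseteq> d (t x) (t y)"
    using n by (simp add: meet_le_left)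
  ultimately have "?u \<sqsubseteq> d x y"
    using le_d_trans[of ?u x "t x" "t y"] le_d_trans[of ?u x "t y" y] by simp
  then show "sat xs a (d x y) t" by (auto simp: sat_def)
qed

text \<open>First the diagonals at variables on which \<open>w\<close> does not depend are dropped.
  At the finitely many others one stage forces all equalities between \<open>t\<close> and
  \<open>t'\<close>.\<close>

lemma sat_cong:
  assumes sat: "sat xs a w t" and w: "w \<in> V" and t: "avoids t xs"
    and t': "\<And>z. z \<in> set xs \<Longrightarrow> c z w \<noteq> w \<Longrightarrow> eqv a (t z) (t' z)"
  shows "sat xs a w t'"
proof -
  obtain m where m: "a m \<sqinter> diag xs t \<sqsubseteq> w" using sat by (auto simp: sat_def)
  obtain m' where m': "m \<le> m'" "\<And>z. z \<in> set xs \<Longrightarrow> a m' \<sqsubseteq> d (t z) (t z)"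
    using avoids_chain_le t by blast
  let ?Z = "{z \<in> set xs. c z w \<noteq> w}"
  have "\<exists>n. a n \<sqsubseteq> d (t z) (t' z)" if "z \<in> ?Z" for z
    using that t' by (auto simp: eqv_def)
  then have "\<exists>n\<ge>m'. \<forall>z\<in>?Z. \<forall>n'\<ge>n. a n' \<sqsubseteq> d (t z) (t' z)"
    using chain_Suc_le by (intro chain_finite_le) auto
  then obtain n where n: "m' \<le> n" "\<And>z. z \<in> ?Z \<Longrightarrow> a n \<sqsubseteq> d (t z) (t' z)"
    by blast
  let ?ys = "filter (\<lambda>z. c z w \<noteq> w) xs"
  have le: "a n \<sqinter> diag ?ys t \<sqsubseteq> w"
    using n m m' t w chain_meet_diag_mono[OF m, of n] chain_le_mono[OF m'(2) n(1)]
      chain_distinct chain_free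
    by (intro meet_diag_le_filter) (auto simp: avoids_def)
  have "a n \<sqinter> diag xs t' \<sqsubseteq> d z (t z)" if "z \<in> ?Z" for z
  proof -
    have "a n \<sqinter> diag xs t' \<sqsubseteq> d z (t' z)" "a n \<sqinter> diag xs t' \<sqsubseteq> d (t' z) (t z)"
      using that n(2)[OF that]
      by (auto intro: meet_le_right meet_le_left diag_le simp: d_commute[of "t' z"])
    then show ?thesis using le_d_trans[of "a n \<sqinter> diag xs t'" z "t' z" "t z"] by simp
  qed
  then have "a n \<sqinter> diag xs t' \<sqsubseteq> a n \<sqinter> diag ?ys t"
    by (simp add: le_meet_iff meet_le1 le_diag_iff)
  then have "a n \<sqinter> diag xs t' \<sqsubseteq> w"
    using le le_trans[of _ "a n \<sqinter> diag ?ys t" w] w by simp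
  then show ?thesis by (auto simp: sat_def)
qed

text \<open>One direction is the Henkin property. For the other, \<open>c x w\<close> is free of
  \<open>x\<close>, so the value at \<open>x\<close> may be changed back.\<close>

lemma sat_c:
  assumes w: "w \<in> V" "w \<in> W" and x: "x \<in> set xs" and t: "avoids t xs"
  shows "sat xs a (c x w) t \<longleftrightarrow> (\<exists>k. k \<notin> set xs \<and> sat xs a w (t(x := k)))"
proof
  assume "sat xs a (c x w) t"
  then show "\<exists>k. k \<notin> set xs \<and> sat xs a w (t(x := k))"
    using H w x t unfolding henkin_chain_def sat_def by blast
next
  assume "\<exists>k. k \<notin> set xs \<and> sat xs a w (t(x := k))"
  then obtain k where k: "k \<notin> set xs" "sat xs a w (t(x := k))" by blast
  have "sat xs a (c x w) (t(x := k))"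
    using k w sat_mono c_increasing by simp
  then show "sat xs a (c x w) t"
  proof (rule sat_cong)
    show "avoids (t(x := k)) xs" using t k by (auto simp: avoids_def)
    show "eqv a ((t(x := k)) z) (t z)" if "z \<in> set xs" "c z (c x w) \<noteq> c x w" for z
      using that w t eqv_refl by (auto simp: avoids_def)
  qed (use w in simp)
qed

end

text \<open>Distinct fresh constants can be generalised away. Cylindrifying \<open>t x\<close> turns
  \<open>d x (t x)\<close> into \<open>d x x\<close>; this is implied by \<open>u\<close> if
  \<open>u\<close> depends on \<open>x\<close>, and otherwise \<open>v\<close> is free of
  \<open>x\<close> too and \<open>c x\<close> removes it. Injectivity keeps \<open>t x\<close> out
  of the remaining diagonals.\<close>

lemma meet_diag_le_cancel:
  assumes "u \<sqinter> diag xs t \<sqsubseteq> v" "u \<in> V" "v \<in> V" "distinct xs" "inj_on t (set xs)"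
    and "\<And>x. x \<in> set xs \<Longrightarrow> t x \<notin> set xs"
    and "\<And>x. x \<in> set xs \<Longrightarrow> c (t x) u = u \<and> c (t x) v = v"
    and "\<And>x. c x u = u \<Longrightarrow> c x v = v"
  shows "u \<sqsubseteq> v"
proof (cases "u = \<zero>")
  case False
  with assms show ?thesis
  proof (induction xs)
    case Nil
    then show ?case by simp
  next
    case (Cons x xs)
    let ?D = "diag xs t" and ?e = "d x (t x)"
    have ne: "x \<noteq> t x"
      using Cons.prems(6) by (metis list.set_intros(1))
    have D: "c x ?D = ?D" "c (t x) ?D = ?D"
      using Cons.prems(4-6) by (auto intro!: diag_free)
    have "(u \<sqinter> ?D) \<sqinter> ?e \<sqsubseteq> v"
      using Cons.prems(1-3) by (simp add: meet_ac)
    then have "c (t x) ((u \<sqinter> ?D) \<sqinter> ?e) \<sqsubseteq> v"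
      using c_mono[of "(u \<sqinter> ?D) \<sqinter> ?e" v "t x"] Cons.prems(2,3,7) by simp
    moreover have "c (t x) ((u \<sqinter> ?D) \<sqinter> ?e) = (u \<sqinter> ?D) \<sqinter> d x x"
      using Cons.prems(2,7) D ne by (simp add: c_meet_free' c_d_right)
    ultimately have le: "(u \<sqinter> ?D) \<sqinter> d x x \<sqsubseteq> v" by simp
    have "u \<sqinter> ?D \<sqsubseteq> v"
    proof (cases "c x u = u")
      case True
      have "c x ((u \<sqinter> ?D) \<sqinter> d x x) = u \<sqinter> ?D"
        using True D Cons.prems(2) by (simp add: c_meet_free')
      then show ?thesis
        using c_mono[OF le, of x] Cons.prems True by simp
    next
      case False
      then have "u \<sqsubseteq> d x x" using Cons.prems c_noteq_iff by metis
      then have "u \<sqinter> ?D \<sqinter> d x x = u \<sqinter> ?D"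
        using Cons.prems(2) by (intro meet_absorb meet_le_left) auto
      with le show ?thesis by simp
    qed
    then show ?case using Cons by simp
  qed
qed (use assms zero_least in simp)

text \<open>The chain starts from \<open>u\<close> with distinct constants substituted for
  \<open>xs\<close>. By \<open>meet_diag_le_cancel\<close> this does not imply \<open>v\<close> at
  the same constants, and the construction preserves that.\<close>

lemma separating_chain_exists:
  assumes inf: "infinite (UNIV :: 'x set)" and cnt: "countable (UNIV :: 'x set)"
    and xs: "distinct xs"
    and W: "countable W" "W \<subseteq> V" "\<And>w z. w \<in> W \<Longrightarrow> z \<notin> set xs \<Longrightarrow> c z w = w"
    and uv: "u \<in> V" "v \<in> V" "\<And>z. z \<notin> set xs \<Longrightarrow> c z u = u \<and> c z v = v"
      "\<And>z. c z u = u \<Longrightarrow> c z v = v" "\<not> u \<sqsubseteq> v"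
  obtains a t where "henkin_chain xs W a" "avoids t xs" "sat xs a u t" "\<not> sat xs a v t"
proof -
  have "infinite (- set xs)"
    using inf by (simp add: Compl_eq_Diff_UNIV)
  then obtain B where B: "finite B" "B \<subseteq> - set xs" "card B = card (set xs)"
    using infinite_arbitrarily_large by metis
  then obtain t where t: "bij_betw t (set xs) B"
    using finite_same_card_bij[of "set xs" B] by auto
  then have inj: "inj_on t (set xs)" and tav: "\<And>z. z \<in> set xs \<Longrightarrow> t z \<notin> set xs"
    using B by (auto simp: bij_betw_def)
  define a0 where "a0 = cyl xs (diag xs t \<sqinter> u)"
  have a0: "a0 \<in> V" "a0 \<sqinter> diag xs t \<sqsubseteq> u"
    using uv xs tav diag_meet_cyl_le[of xs t u] by (simp_all add: a0_def meet_commute)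
  have "\<not> a0 \<sqinter> diag xs t \<sqsubseteq> v"
  proof
    assume le: "a0 \<sqinter> diag xs t \<sqsubseteq> v"
    have "u \<sqinter> diag xs t \<sqsubseteq> a0"
      using cyl_increasing[of "diag xs t \<sqinter> u" xs] uv by (simp add: a0_def meet_commute)
    then have "u \<sqinter> diag xs t \<sqsubseteq> a0 \<sqinter> diag xs t"
      using uv a0 by (simp add: le_meet_iff meet_le2)
    then have "u \<sqinter> diag xs t \<sqsubseteq> v"
      using le le_trans[of _ "a0 \<sqinter> diag xs t" v] uv a0 by simp
    then have "u \<sqsubseteq> v"
      using uv xs inj tav by (intro meet_diag_le_cancel[of u xs t v]) auto
    with uv show False by simp
  qed
  then have "refutes xs t v a0"
    using a0 uv by (auto simp: refutes_def a0_def cyl_free)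
  then obtain a where a: "henkin_chain xs W a" "\<And>n. a n \<sqsubseteq> a0" "\<And>n. \<not> a n \<sqinter> diag xs t \<sqsubseteq> v"
    using henkin_chain_exists[OF inf cnt xs W uv(2), of t a0] uv(3) by blast
  have "a 0 \<sqinter> diag xs t \<sqsubseteq> u"
    using le_trans[of "a 0 \<sqinter> diag xs t" "a0 \<sqinter> diag xs t" u] a(2)[of 0] a0 uv chain_closed[OF a(1)]
    by (simp add: meet_mono)
  with a tav show ?thesis
    by (intro that[of a t]) (auto simp: sat_def avoids_def)
qed

end


subsection \<open>Tables from a satisfaction relation\<close>

text \<open>\<open>K\<close> holds names of base elements and \<open>r\<close> identifies names of
  the same element. \<open>Sat_separates\<close> presupposes an assignment satisfying
  \<open>u\<close>; in the reduced product it fills the coordinates that do not separate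
  \<open>u\<close> from \<open>v\<close>.\<close>

locale table_interpretation = projectional_semilattice +
  fixes K :: "'k set"
    and r :: "'k \<Rightarrow> 'g"
    and Sat :: "'a \<Rightarrow> ('b \<Rightarrow> 'k) \<Rightarrow> bool"
  assumes K_nonempty: "K \<noteq> {}"
    and Sat_zero: "range t \<subseteq> K \<Longrightarrow> \<not> Sat \<zero> t"
    and Sat_one: "Sat \<one> t"
    and Sat_meet: "\<lbrakk>u \<in> V; v \<in> V; range t \<subseteq> K\<rbrakk> \<Longrightarrow> Sat (u \<sqinter> v) t \<longleftrightarrow> Sat u t \<and> Sat v t"
    and Sat_c: "\<lbrakk>u \<in> V; range t \<subseteq> K\<rbrakk> \<Longrightarrow> Sat (c x u) t \<longleftrightarrow> (\<exists>k\<in>K. Sat u (t(x := k)))"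
    and Sat_d: "range t \<subseteq> K \<Longrightarrow> Sat (d x y) t \<longleftrightarrow> r (t x) = r (t y)"
    and Sat_cong: "\<lbrakk>u \<in> V; range t \<subseteq> K; range t' \<subseteq> K; Sat u t;
        \<And>x. x \<in> domain u \<Longrightarrow> r (t x) = r (t' x)\<rbrakk> \<Longrightarrow> Sat u t'"
    and Sat_separates: "\<lbrakk>u \<in> V; v \<in> V; u \<noteq> \<zero>; domain v \<subseteq> domain u; \<not> u \<sqsubseteq> v;
        range t \<subseteq> K; Sat u t\<rbrakk> \<Longrightarrow> \<exists>t'. range t' \<subseteq> K \<and> Sat u t' \<and> \<not> Sat v t'"
begin

definition G :: "'g set" where
  "G = r ` K"

definition tup :: "'b set \<Rightarrow> ('b \<Rightarrow> 'k) \<Rightarrow> 'b \<rightharpoonup> 'g" where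
  "tup X t = (Some \<circ> r \<circ> t) |` X"

definition table :: "'a \<Rightarrow> ('b \<rightharpoonup> 'g) set" where
  "table u = {tup (domain u) t | t. range t \<subseteq> K \<and> Sat u t}"

lemma tup_in_tuples: "range t \<subseteq> K \<Longrightarrow> tup X t \<in> tuples G X"
  by (auto simp: tup_def tuples_def G_def ran_def restrict_map_def split: if_splits)

lemma tup_eq_iff: "tup X t = tup X t' \<longleftrightarrow> (\<forall>x\<in>X. r (t x) = r (t' x))"
  by (auto simp: tup_def restrict_map_def fun_eq_iff)

lemma tup_restrict: "tup X t |` Y = tup (X \<inter> Y) t"
  by (simp add: tup_def)

lemma tuples_tup:
  assumes "s \<in> tuples G X"
  shows "\<exists>t. range t \<subseteq> K \<and> s = tup X t"
proof -
  have s: "dom s = X" "ran s \<subseteq> r ` K" using assms by (auto simp: tuples_def G_def)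
  obtain k0 where k0: "k0 \<in> K" using K_nonempty by blast
  have "\<exists>k\<in>K. x \<in> X \<longrightarrow> s x = Some (r k)" for x
  proof (cases "x \<in> X")
    case True
    then obtain g where g: "s x = Some g" using s by auto
    then have "g \<in> r ` K" using s(2) ranI[of s x g] by blast
    with g show ?thesis by blast
  qed (use k0 in blast)
  then obtain t where t: "\<And>x. t x \<in> K" "\<And>x. x \<in> X \<Longrightarrow> s x = Some (r (t x))"
    unfolding Bex_def by (metis (no_types))
  have "s x = tup X t x" for x
    using t(2)[of x] domIff[of x s] s(1) by (cases "x \<in> X") (simp_all add: tup_def)
  then have "s = tup X t" by blast
  moreover have "range t \<subseteq> K" using t(1) by blast
  ultimately show ?thesis by blast
qed

lemma tup_in_table_iff:
  assumes "u \<in> V" "range t \<subseteq> K"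
  shows "tup (domain u) t \<in> table u \<longleftrightarrow> Sat u t"
proof
  assume "tup (domain u) t \<in> table u"
  then obtain t' where "range t' \<subseteq> K" "Sat u t'" "tup (domain u) t = tup (domain u) t'"
    by (auto simp: table_def)
  then show "Sat u t" using assms Sat_cong[of u t' t] by (auto simp: tup_eq_iff)
qed (use assms in \<open>auto simp: table_def\<close>)

lemma tableE:
  assumes "s \<in> table u"
  obtains t where "s = tup (domain u) t" "range t \<subseteq> K" "Sat u t"
  using assms by (auto simp: table_def)

text \<open>Cylindrifying shrinks the finite domain until only \<open>\<one>\<close> remains; on the
  way back \<open>Sat_c\<close> supplies the values.\<close>

lemma Sat_exists:
  assumes "u \<in> V" "u \<noteq> \<zero>"
  shows "\<exists>t. range t \<subseteq> K \<and> Sat u t"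
proof -
  have "finite (domain u)" using assms domain_finite by blast
  then show ?thesis using assms
  proof (induction "domain u" arbitrary: u rule: finite_psubset_induct)
    case psubset
    show ?case
    proof (cases "domain u = {}")
      case True
      then have "u = \<one>" using psubset domain_empty by blast
      moreover obtain k where "k \<in> K" using K_nonempty by blast
      ultimately show ?thesis using Sat_one by (intro exI[of _ "\<lambda>_. k"]) auto
    next
      case False
      then obtain x where x: "x \<in> domain u" by blast
      then have "domain (c x u) \<subset> domain u" using psubset.prems domain_c by auto
      then obtain t where t: "range t \<subseteq> K" "Sat (c x u) t"
        using psubset c_neq_zero by (metis c_closed)
      then obtain k where "k \<in> K" "Sat u (t(x := k))" using psubset Sat_c by blast
      with t show ?thesis by (intro exI[of _ "t(x := k)"]) auto
    qed
  qed
qed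

lemma table_zero: "table \<zero> = {}"
  using Sat_zero by (auto simp: table_def)

lemma table_nonempty: "u \<in> V \<Longrightarrow> u \<noteq> \<zero> \<Longrightarrow> table u \<noteq> {}"
  using Sat_exists[of u] unfolding table_def by blast

lemma table_subset: "table u \<subseteq> tuples G (domain u)"
  using tup_in_tuples by (auto simp: table_def)

lemma schema_table: "u \<in> V \<Longrightarrow> schema G (table u) = domain u"
  using schema_eq[OF table_nonempty table_subset]
  by (cases "u = \<zero>") (auto simp: table_zero domain_zero schema_def)

lemma table_one: "table \<one> = {Map.empty}"
proof -
  have "tup {} t = Map.empty" for t by (simp add: tup_def)
  then show ?thesis
    using table_nonempty[of \<one>] one_neq_zero unfolding table_def domain_one by auto
qed

lemma table_meet:
  assumes "u \<in> V" "v \<in> V"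
  shows "table (u \<sqinter> v) = join G (table u) (table v)"
proof (cases "u = \<zero> \<or> v = \<zero>")
  case True
  then have "u \<sqinter> v = \<zero>"
    using assms by auto
  moreover have "table u = {} \<or> table v = {}" using True table_zero by blast
  ultimately show ?thesis by (simp add: table_zero join_def)
next
  case False
  have join: "join G (table u) (table v) =
      {s \<in> tuples G (domain u \<union> domain v). s |` domain u \<in> table u \<and> s |` domain v \<in> table v}"
    using False assms by (simp add: join_def table_nonempty schema_table)
  have mem: "tup (domain u \<union> domain v) t \<in> join G (table u) (table v) \<longleftrightarrow> Sat (u \<sqinter> v) t"
    if t: "range t \<subseteq> K" for t
  proof -
    have "(domain u \<union> domain v) \<inter> domain u = domain u" "(domain u \<union> domain v) \<inter> domain v = domain v"
      by auto
    then show ?thesis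
      using assms t by (simp add: join tup_restrict tup_in_tuples tup_in_table_iff Sat_meet)
  qed
  have sub: "join G (table u) (table v) \<subseteq> tuples G (domain u \<union> domain v)"
    by (auto simp: join)
  show ?thesis
  proof (cases "u \<sqinter> v = \<zero>")
    case True
    \<comment> \<open>The domain of the meet is no longer the union of the domains here. The join is
      empty because each of its tuples would satisfy \<open>\<zero>\<close>.\<close>
    have "s \<notin> join G (table u) (table v)" for s
    proof
      assume s: "s \<in> join G (table u) (table v)"
      then obtain t where t: "range t \<subseteq> K" "s = tup (domain u \<union> domain v) t"
        using sub tuples_tup[of s] by blast
      then show False using mem[OF t(1)] s Sat_zero[OF t(1)] True by simp
    qed
    then have "join G (table u) (table v) = {}" by blast
    with True show ?thesis by (simp add: table_zero)
  next
    case nz: False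
    show ?thesis
    proof (intro set_eqI iffI)
      fix s assume "s \<in> table (u \<sqinter> v)"
      then show "s \<in> join G (table u) (table v)"
        using mem domain_meet[OF assms nz] unfolding table_def by auto
    next
      fix s assume s: "s \<in> join G (table u) (table v)"
      then obtain t where t: "range t \<subseteq> K" "s = tup (domain u \<union> domain v) t"
        using sub tuples_tup[of s] by blast
      then have "Sat (u \<sqinter> v) t" using mem s by blast
      then show "s \<in> table (u \<sqinter> v)"
        using t assms nz by (auto simp: table_def domain_meet)
    qed
  qed
qed

lemma table_c:
  assumes u: "u \<in> V"
  shows "table (c x u) = del G x (table u)"
proof (cases "u = \<zero>")
  case True
  then show ?thesis by (simp add: c_zero table_zero del_def)
next
  case False
  have *: "domain u \<inter> (domain u - {x}) = domain u - {x}" by auto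
  have "del G x (table u) = (\<lambda>s. s |` (domain u - {x})) ` table u"
    using u by (simp add: del_def schema_table)
  also have "\<dots> = {tup (domain u) t |` (domain u - {x}) | t. range t \<subseteq> K \<and> Sat u t}"
    unfolding table_def by blast
  also have "\<dots> = {tup (domain u - {x}) t | t. range t \<subseteq> K \<and> Sat u t}"
    by (simp add: tup_restrict *)
  also have "\<dots> = {tup (domain u - {x}) t | t. range t \<subseteq> K \<and> Sat (c x u) t}"
  proof (intro set_eqI iffI; elim CollectE exE conjE)
    fix s t assume t: "s = tup (domain u - {x}) t" "range t \<subseteq> K" "Sat u t"
    then have "Sat (c x u) t"
      unfolding Sat_c[OF u t(2)] by (intro bexI[of _ "t x"]) auto
    with t show "s \<in> {tup (domain u - {x}) t | t. range t \<subseteq> K \<and> Sat (c x u) t}" by blast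
  next
    fix s t assume t: "s = tup (domain u - {x}) t" "range t \<subseteq> K" "Sat (c x u) t"
    then obtain k where k: "k \<in> K" "Sat u (t(x := k))" using Sat_c u by blast
    moreover have "s = tup (domain u - {x}) (t(x := k))"
      using t by (simp add: tup_eq_iff)
    moreover have "range (t(x := k)) \<subseteq> K" using t k by auto
    ultimately show "s \<in> {tup (domain u - {x}) t | t. range t \<subseteq> K \<and> Sat u t}" by blast
  qed
  also have "\<dots> = table (c x u)"
    using u False by (simp add: table_def domain_c)
  finally show ?thesis by simp
qed

lemma table_d: "table (d x y) = eq_table G x y"
proof (intro set_eqI iffI)
  fix s assume "s \<in> table (d x y)"
  then show "s \<in> eq_table G x y"
    using tup_in_tuples by (auto elim!: tableE simp: eq_table_def domain_d Sat_d)
       (simp add: tup_def)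
next
  fix s assume s: "s \<in> eq_table G x y"
  then obtain t where t: "range t \<subseteq> K" "s = tup {x, y} t"
    using tuples_tup[of s "{x, y}"] by (auto simp: eq_table_def)
  then have "Sat (d x y) t" using s by (simp add: eq_table_def tup_def Sat_d)
  with t show "s \<in> table (d x y)" by (auto simp: table_def domain_d)
qed

text \<open>Equal tables have equal schemas, hence equal domains, so a failure of
  \<open>\<sqsubseteq>\<close> in either direction would be witnessed by a separating tuple.\<close>

lemma inj_on_table: "inj_on table V"
proof (rule inj_onI)
  have le: "u \<sqsubseteq> v" if uv: "u \<in> V" "v \<in> V" "table u = table v" for u v
  proof (rule ccontr)
    assume nle: "\<not> u \<sqsubseteq> v"
    have dom: "domain u = domain v" using uv schema_table by metis
    have "u \<noteq> \<zero>" using nle uv zero_least by metis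
    then obtain t where "range t \<subseteq> K" "Sat u t" using Sat_exists[of u] uv by blast
    then obtain t' where "range t' \<subseteq> K" "Sat u t'" "\<not> Sat v t'"
      using Sat_separates[OF uv(1,2) _ _ nle] dom \<open>u \<noteq> \<zero>\<close> by blast
    then show False
      using uv dom tup_in_table_iff[of u t'] tup_in_table_iff[of v t'] by simp
  qed
  show "u = v" if "u \<in> V" "v \<in> V" "table u = table v" for u v
    using that by (intro le_antisym le) auto
qed

lemma table_in_Tab:
  assumes "u \<in> V"
  shows "table u \<in> Tab G"
proof (cases "u = \<zero>")
  case True
  then show ?thesis by (auto simp: table_zero Tab_def)
next
  case False
  then show ?thesis using assms table_subset domain_finite by (auto simp: Tab_def)
qed

lemma conjunctive_table_algebra_range: "conjunctive_table_algebra G (table ` V)"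
  unfolding conjunctive_table_algebra_def
proof (intro conjI ballI allI)
  show "table ` V \<subseteq> Tab G" using table_in_Tab by blast
  show "{} \<in> table ` V" using table_zero zero_closed by blast
  show "{Map.empty} \<in> table ` V" using table_one one_closed by blast
  show "eq_table G x y \<in> table ` V" for x y using table_d d_closed by blast
  show "join G S T \<in> table ` V" if "S \<in> table ` V" "T \<in> table ` V" for S T
    using that table_meet meet_closed by blast
  show "del G x T \<in> table ` V" if "T \<in> table ` V" for x T
    using that table_c c_closed by blast
qed

end


subsection \<open>The reduced product of Henkin chains\<close>

text \<open>
  The indices are lists instead of finite sets only because the type of the base consists of sets of
  lists.
\<close>

definition supersets :: "'i list filter" where
  "supersets = filtercomap set (finite_subsets_at_top UNIV)"

lemma eventually_supersets:
  "eventually P supersets \<longleftrightarrow> (\<exists>Q. finite Q \<and> (\<forall>i. Q \<subseteq> set i \<longrightarrow> P i))"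
proof
  assume "eventually P supersets"
  then show "\<exists>Q. finite Q \<and> (\<forall>i. Q \<subseteq> set i \<longrightarrow> P i)"
    unfolding supersets_def eventually_filtercomap eventually_finite_subsets_at_top
    by (metis List.finite_set subset_UNIV)
next
  assume "\<exists>Q. finite Q \<and> (\<forall>i. Q \<subseteq> set i \<longrightarrow> P i)"
  then obtain Q where Q: "finite Q" "\<And>i. Q \<subseteq> set i \<Longrightarrow> P i" by blast
  show "eventually P supersets"
    unfolding supersets_def eventually_filtercomap eventually_finite_subsets_at_top
    using Q by (intro exI[of _ "\<lambda>Y. Q \<subseteq> Y"] conjI exI[of _ Q]) auto
qed

lemma supersets_ne_bot: "supersets \<noteq> bot"
proof -
  have "\<not> eventually (\<lambda>_. False) (supersets :: 'i list filter)"
    using finite_list by (auto simp: eventually_supersets)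
  then show ?thesis by (metis eventually_bot)
qed

text \<open>The second components of an index are its formula variables; the first components are
  the elements its chain has to care about.\<close>

definition vars :: "('v \<times> 'x) list \<Rightarrow> 'x list" where
  "vars i = remdups (map snd i)"

lemma eventually_vars: "finite X \<Longrightarrow> \<forall>\<^sub>F i in supersets. X \<subseteq> set (vars i)"
  unfolding eventually_supersets vars_def
  by (intro exI[of _ "Pair undefined ` X"]) force

text \<open>Codes a function on indices within the type of the base: the value at \<open>i\<close>
  is stored as the last entry of a list extending \<open>i\<close>.\<close>

definition graph_lists :: "(('v \<times> 'x) list \<Rightarrow> 'x) \<Rightarrow> ('v \<times> 'x) list set" where
  "graph_lists f = range (\<lambda>i. i @ [(undefined, f i)])"

lemma inj_graph_lists: "inj graph_lists"
proof (rule injI, rule ext)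
  fix f g :: "('v \<times> 'x) list \<Rightarrow> 'x" and i
  assume "graph_lists f = graph_lists g"
  then have "i @ [(undefined, f i)] \<in> graph_lists g"
    by (auto simp: graph_lists_def)
  then show "f i = g i" by (auto simp: graph_lists_def)
qed

section \<open>A Henkin chain for every index\<close>

context projectional_semilattice
begin

definition tasks :: "('v \<times> 'x) list \<Rightarrow> 'v set" where
  "tasks i = {w \<in> V \<inter> fst ` set i. \<forall>z. z \<notin> set (vars i) \<longrightarrow> c z w = w}"

lemma eventually_tasks:
  assumes "w \<in> V" "w \<noteq> \<zero>"
  shows "\<forall>\<^sub>F i in supersets. w \<in> tasks i"
proof -
  have "\<forall>\<^sub>F i in supersets. domain w \<subseteq> set (vars i)"
    using assms by (intro eventually_vars domain_finite)
  moreover have "\<forall>\<^sub>F i in supersets. w \<in> fst ` set i"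
    unfolding eventually_supersets by (intro exI[of _ "{(w, undefined)}"]) force
  ultimately show ?thesis
    by eventually_elim (use assms in \<open>auto simp: tasks_def intro!: c_not_mem_domain\<close>)
qed

definition separates :: "('v \<times> 'x) list \<Rightarrow> (nat \<Rightarrow> 'v) \<Rightarrow> 'v \<Rightarrow> 'v \<Rightarrow> bool" where
  "separates i a u v \<longleftrightarrow> (\<exists>t. avoids t (vars i) \<and> sat (vars i) a u t \<and> \<not> sat (vars i) a v t)"

text \<open>Dependence is expressed by \<open>c\<close> instead of \<open>domain\<close>, as
  \<open>domain \<zero>\<close> contains all variables although
  \<open>c z \<zero> = \<zero>\<close>. Thus \<open>v\<close> may be zero.\<close>

definition separable :: "'x list \<Rightarrow> 'v \<Rightarrow> 'v \<Rightarrow> bool" where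
  "separable xs u v \<longleftrightarrow> u \<in> V \<and> v \<in> V \<and> (\<forall>z. z \<notin> set xs \<longrightarrow> c z u = u \<and> c z v = v) \<and>
     (\<forall>z. c z u = u \<longrightarrow> c z v = v) \<and> \<not> u \<sqsubseteq> v"

text \<open>
  The first two entries of an index are the pair of elements that its chain has to tell apart. A pair
  occurs in this position in arbitrarily large indices, which is why the reduced product tells it
  apart.
\<close>

lemma index_chain_exists:
  assumes "infinite (UNIV :: 'x set)" "countable (UNIV :: 'x set)"
  shows "\<exists>a. henkin_chain (vars i) (tasks i) a \<and>
    (\<forall>u v p q j. i = (u, p) # (v, q) # j \<longrightarrow> separable (vars i) u v \<longrightarrow> separates i a u v)"
proof -
  have ex: "\<exists>a. henkin_chain (vars i) (tasks i) a \<and> separates i a u v"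
    if "separable (vars i) u v" for u v
  proof -
    have "distinct (vars i)" "countable (tasks i)" "tasks i \<subseteq> V"
      "\<And>w z. w \<in> tasks i \<Longrightarrow> z \<notin> set (vars i) \<Longrightarrow> c z w = w"
      by (auto simp: vars_def tasks_def intro: countable_finite)
    then show ?thesis
      using separating_chain_exists[OF assms, of "vars i" "tasks i" u v] that
      unfolding separable_def separates_def by metis
  qed
  show ?thesis
  proof (cases "\<exists>u v p q j. i = (u, p) # (v, q) # j \<and> separable (vars i) u v")
    case True
    then show ?thesis using ex by auto
  next
    case False
    \<comment> \<open>Default pair for indices that do not name a separable one; any Henkin chain
      will do there.\<close>
    have "separable (vars i) \<one> \<zero>"
      using one_neq_zero by (simp add: separable_def c_zero le_zero_iff)
    with ex False show ?thesis by blast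
  qed
qed

end

section \<open>Satisfaction in the reduced product\<close>

locale chain_family = projectional_semilattice +
  fixes A :: "('a \<times> 'b) list \<Rightarrow> nat \<Rightarrow> 'a"
  assumes infinite_vars: "infinite (UNIV :: 'b set)"
    and chain: "henkin_chain (vars i) (tasks i) (A i)"
    and chain_separates: "separable (vars ((u, p) # (v, q) # j)) u v \<Longrightarrow>
      separates ((u, p) # (v, q) # j) (A ((u, p) # (v, q) # j)) u v"
begin

definition K :: "(('a \<times> 'b) list \<Rightarrow> 'b) set" where
  "K = {f. \<forall>i. f i \<notin> set (vars i)}"

definition Sat :: "'a \<Rightarrow> ('b \<Rightarrow> ('a \<times> 'b) list \<Rightarrow> 'b) \<Rightarrow> bool" where
  "Sat w t \<longleftrightarrow> (\<forall>\<^sub>F i in supersets. sat (vars i) (A i) w (\<lambda>x. t x i))"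

definition equal :: "(('a \<times> 'b) list \<Rightarrow> 'b) \<Rightarrow> (('a \<times> 'b) list \<Rightarrow> 'b) \<Rightarrow> bool" where
  "equal f g \<longleftrightarrow> (\<forall>\<^sub>F i in supersets. eqv (A i) (f i) (g i))"

lemma avoids_K: "range t \<subseteq> K \<Longrightarrow> avoids (\<lambda>x. t x i) (vars i)"
  by (auto simp: K_def avoids_def)

lemma equal_refl: "f \<in> K \<Longrightarrow> equal f f"
  using eqv_refl[OF chain] by (simp add: equal_def K_def)

lemma equal_sym: "equal f g \<Longrightarrow> equal g f"
  unfolding equal_def by (erule eventually_mono) (rule eqv_sym[OF chain])

lemma equal_trans: "equal f g \<Longrightarrow> equal g h \<Longrightarrow> equal f h"
  unfolding equal_def by (rule eventually_elim2) (assumption+, rule eqv_trans[OF chain])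

lemma Sat_zero:
  assumes "range t \<subseteq> K"
  shows "\<not> Sat \<zero> t"
  by (simp add: Sat_def sat_zero[OF chain avoids_K[OF assms]] eventually_const[OF supersets_ne_bot])

lemma Sat_one: "Sat \<one> t"
  using sat_one[OF chain] by (simp add: Sat_def)

lemma Sat_meet: "\<lbrakk>u \<in> V; v \<in> V\<rbrakk> \<Longrightarrow> Sat (u \<sqinter> v) t \<longleftrightarrow> Sat u t \<and> Sat v t"
  unfolding Sat_def by (simp add: sat_meet[OF chain] eventually_conj_iff)

lemma Sat_c:
  assumes u: "u \<in> V" and t: "range t \<subseteq> K"
  shows "Sat (c x u) t \<longleftrightarrow> (\<exists>k\<in>K. Sat u (t(x := k)))"
proof (cases "u = \<zero>")
  case True
  have "range (t(x := k)) \<subseteq> K" if "k \<in> K" for k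
    using t that by auto
  with True t Sat_zero show ?thesis by (auto simp: c_zero)
next
  case False
  have upd: "(\<lambda>z. (t(x := f)) z i) = (\<lambda>z. t z i)(x := f i)" for f i
    by auto
  have ev: "\<forall>\<^sub>F i in supersets. u \<in> tasks i \<and> x \<in> set (vars i)"
    using eventually_tasks[OF u False] eventually_vars[of "{x}"]
    by (simp add: eventually_conj_iff)
  show ?thesis
  proof
    assume sat: "Sat (c x u) t"
    have "\<exists>k. k \<notin> set (vars i) \<and>
        (sat (vars i) (A i) (c x u) (\<lambda>z. t z i) \<and> u \<in> tasks i \<and> x \<in> set (vars i) \<longrightarrow>
         sat (vars i) (A i) u ((\<lambda>z. t z i)(x := k)))" for i
    proof (cases "sat (vars i) (A i) (c x u) (\<lambda>z. t z i) \<and> u \<in> tasks i \<and> x \<in> set (vars i)")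
      case True
      then show ?thesis using sat_c[OF chain u] avoids_K[OF t] by blast
    next
      case False
      \<comment> \<open>Where nothing has to be witnessed any constant serves, so that the chosen
        function lies in \<open>K\<close>.\<close>
      then show ?thesis using ex_new_if_finite[OF infinite_vars] by blast
    qed
    then obtain f where f: "\<And>i. f i \<notin> set (vars i)"
      "\<And>i. sat (vars i) (A i) (c x u) (\<lambda>z. t z i) \<Longrightarrow> u \<in> tasks i \<Longrightarrow> x \<in> set (vars i) \<Longrightarrow>
         sat (vars i) (A i) u ((\<lambda>z. t z i)(x := f i))"
      by metis
    have "Sat u (t(x := f))"
      unfolding Sat_def upd using ev sat[unfolded Sat_def]
      by eventually_elim (use f(2) in blast)
    with f(1) show "\<exists>k\<in>K. Sat u (t(x := k))" by (auto simp: K_def)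
  next
    assume "\<exists>k\<in>K. Sat u (t(x := k))"
    then obtain f where f: "f \<in> K" "Sat u (t(x := f))" by blast
    show "Sat (c x u) t"
      unfolding Sat_def using ev f(2)[unfolded Sat_def upd]
    proof eventually_elim
      case (elim i)
      then show ?case
        using sat_c[OF chain u _ _ avoids_K[OF t]] f(1) by (auto simp: K_def)
    qed
  qed
qed

lemma Sat_d:
  assumes "range t \<subseteq> K"
  shows "Sat (d x y) t \<longleftrightarrow> equal (t x) (t y)"
proof -
  have "\<forall>\<^sub>F i in supersets. {x, y} \<subseteq> set (vars i)"
    by (rule eventually_vars) simp
  then have "\<forall>\<^sub>F i in supersets.
      sat (vars i) (A i) (d x y) (\<lambda>z. t z i) \<longleftrightarrow> eqv (A i) (t x i) (t y i)"
    by eventually_elim (use sat_d[OF chain avoids_K[OF assms]] in auto)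
  then show ?thesis
    unfolding Sat_def equal_def by (rule eventually_subst)
qed

text \<open>A satisfied element is nonzero and so has a finite domain; hence the finitely many
  equalities hold simultaneously at almost all indices.\<close>

lemma Sat_cong:
  assumes u: "u \<in> V" and t: "range t \<subseteq> K" and sat: "Sat u t"
    and eq: "\<And>x. x \<in> domain u \<Longrightarrow> equal (t x) (t' x)"
  shows "Sat u t'"
proof -
  have nz: "u \<noteq> \<zero>" using Sat_zero t sat by blast
  have "\<forall>\<^sub>F i in supersets. \<forall>x\<in>domain u. eqv (A i) (t x i) (t' x i)"
    using eq domain_finite[OF u nz] by (simp add: equal_def eventually_ball_finite)
  with sat[unfolded Sat_def] show ?thesis
    unfolding Sat_def
    by eventually_elim
      (auto intro!: sat_cong[OF chain _ u avoids_K[OF t]] simp: mem_domain_iff[OF u nz])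
qed

text \<open>The separating indices meet every set of the filter. Taking separating values there and
  those of \<open>t\<close> elsewhere satisfies \<open>u\<close> almost everywhere, while
  \<open>v\<close> fails on arbitrarily large indices.\<close>

lemma Sat_separates:
  assumes u: "u \<in> V" "u \<noteq> \<zero>" and v: "v \<in> V" "domain v \<subseteq> domain u" and nle: "\<not> u \<sqsubseteq> v"
    and t: "range t \<subseteq> K" "Sat u t"
  shows "\<exists>t'. range t' \<subseteq> K \<and> Sat u t' \<and> \<not> Sat v t'"
proof -
  have free: "c z u = u \<and> c z v = v" if "z \<notin> domain u" for z
    using that u v c_not_mem_domain by blast
  have sep: "separable xs u v" if "domain u \<subseteq> set xs" for xs
    unfolding separable_def using free u v nle that mem_domain_iff by blast
  define good where
    "good i \<longleftrightarrow> domain u \<subseteq> set (vars i) \<and> (\<exists>p q j. i = (u, p) # (v, q) # j)" for i :: "('a \<times> 'b) list"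
  have "\<exists>s. avoids s (vars i) \<and> sat (vars i) (A i) u s \<and> \<not> sat (vars i) (A i) v s"
    if gi: "good i" for i
  proof -
    obtain p q j where i: "i = (u, p) # (v, q) # j" "domain u \<subseteq> set (vars i)"
      using gi unfolding good_def by blast
    then show ?thesis
      using chain_separates[of u p v q j] sep[of "vars i"] by (simp add: separates_def)
  qed
  then obtain s where s: "\<And>i. good i \<Longrightarrow> avoids (s i) (vars i)"
      "\<And>i. good i \<Longrightarrow> sat (vars i) (A i) u (s i)" "\<And>i. good i \<Longrightarrow> \<not> sat (vars i) (A i) v (s i)"
    by metis
  define t' where "t' x i = (if good i \<and> x \<in> set (vars i) then s i x else t x i)" for x i
  have sat_s: "sat (vars i) (A i) w (\<lambda>x. t' x i) \<longleftrightarrow> sat (vars i) (A i) w (s i)" if "good i" for i w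
    using that by (intro sat_diag_cong) (simp add: t'_def)
  have sat_t: "sat (vars i) (A i) w (\<lambda>x. t' x i) \<longleftrightarrow> sat (vars i) (A i) w (\<lambda>x. t x i)"
    if "\<not> good i" for i w
    using that by (intro sat_diag_cong) (simp add: t'_def)
  show ?thesis
  proof (intro exI[of _ t'] conjI)
    have "t' x i \<notin> set (vars i)" for x i
      using s(1)[of i] t(1) by (auto simp: t'_def avoids_def K_def)
    then show "range t' \<subseteq> K" by (auto simp: K_def)
    show "Sat u t'"
      using t(2) unfolding Sat_def
      by (rule eventually_mono) (use sat_s sat_t s(2) in blast)
    show "\<not> Sat v t'"
    proof
      assume "Sat v t'"
      then obtain Q where Q: "finite Q"
          "\<And>i. Q \<subseteq> set i \<Longrightarrow> sat (vars i) (A i) v (\<lambda>x. t' x i)"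
        unfolding Sat_def eventually_supersets by blast
      \<comment> \<open>Besides \<open>Q\<close>, the index must mention all variables of
        \<open>u\<close> for the pair to be separable at it.\<close>
      obtain j where j: "set j = Q \<union> Pair u ` domain u"
        using finite_list[of "Q \<union> Pair u ` domain u"] Q(1) domain_finite u by auto
      define i where "i = (u, undefined) # (v, undefined) # j"
      have "domain u \<subseteq> snd ` set i" using j by (force simp: i_def)
      then have "good i" by (auto simp: good_def i_def vars_def)
      moreover have "Q \<subseteq> set i" using j by (auto simp: i_def)
      ultimately show False using Q(2) sat_s s(3) by blast
    qed
  qed
qed

text \<open>Each class modulo \<open>equal\<close> is replaced by the code of one chosen member,
  since a class would be a set of functions and not fit the type of the base.\<close>

definition rep :: "(('a \<times> 'b) list \<Rightarrow> 'b) \<Rightarrow> ('a \<times> 'b) list set" where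
  "rep f = graph_lists (SOME g. g \<in> K \<and> equal f g)"

lemma rep_eq_iff:
  assumes "f \<in> K" "g \<in> K"
  shows "rep f = rep g \<longleftrightarrow> equal f g"
proof
  have some: "(SOME h. h \<in> K \<and> equal k h) \<in> K \<and> equal k (SOME h. h \<in> K \<and> equal k h)" if "k \<in> K" for k
    by (rule someI[of _ k]) (use that equal_refl in simp)
  assume "rep f = rep g"
  then have "(SOME h. h \<in> K \<and> equal f h) = (SOME h. h \<in> K \<and> equal g h)"
    unfolding rep_def by (rule injD[OF inj_graph_lists])
  then show "equal f g"
    using some[OF assms(1)] some[OF assms(2)] equal_sym[of g] equal_trans[of f] by auto
next
  assume "equal f g"
  then have "equal f h \<longleftrightarrow> equal g h" for h
    using equal_sym[of f g] equal_trans[of f g h] equal_trans[of g f h] by blast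
  then show "rep f = rep g" by (simp add: rep_def)
qed

lemma K_nonempty: "K \<noteq> {}"
proof -
  have "\<exists>x. x \<notin> set (vars i)" for i :: "('a \<times> 'b) list"
    using ex_new_if_finite[OF infinite_vars] by blast
  then obtain f :: "('a \<times> 'b) list \<Rightarrow> 'b" where "\<And>i. f i \<notin> set (vars i)" by metis
  then show ?thesis by (auto simp: K_def)
qed

lemma table_interpretation_Sat: "table_interpretation V meet zero one c d domain K rep Sat"
proof (intro table_interpretation.intro table_interpretation_axioms.intro)
  show "projectional_semilattice V meet zero one c d domain" ..
  show "Sat (d x y) t \<longleftrightarrow> rep (t x) = rep (t y)" if "range t \<subseteq> K" for t x y
    using that by (subst rep_eq_iff) (auto simp: Sat_d)
  show "Sat u t'" if "u \<in> V" "range t \<subseteq> K" "range t' \<subseteq> K" "Sat u t"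
      "\<And>x. x \<in> domain u \<Longrightarrow> rep (t x) = rep (t' x)" for u t t'
    using that(1,2,4)
  proof (rule Sat_cong)
    show "equal (t x) (t' x)" if "x \<in> domain u" for x
      using \<open>range t \<subseteq> K\<close> \<open>range t' \<subseteq> K\<close> \<open>x \<in> domain u \<Longrightarrow> rep (t x) = rep (t' x)\<close> that
      by (metis range_subsetD rep_eq_iff)
  qed
qed (simp_all add: K_nonempty Sat_zero Sat_one Sat_meet Sat_c Sat_separates[unfolded le_def])

end

theorem theorem3:
  fixes V :: "'v set"
    and meet :: "'v \<Rightarrow> 'v \<Rightarrow> 'v"
    and zero one :: 'v
    and c :: "'x \<Rightarrow> 'v \<Rightarrow> 'v"
    and d :: "'x \<Rightarrow> 'x \<Rightarrow> 'v"
    and domain :: "'v \<Rightarrow> 'x set"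
  assumes "countable (UNIV :: 'x set)" and "infinite (UNIV :: 'x set)"
    and "projectional_semilattice V meet zero one c d domain"
  shows "\<exists>(G :: ('v, 'x) base set) (A :: ('x \<rightharpoonup> ('v, 'x) base) set set)
           (\<phi> :: 'v \<Rightarrow> ('x \<rightharpoonup> ('v, 'x) base) set).
      conjunctive_table_algebra G A \<and>
      bij_betw \<phi> V A \<and>
      (\<forall>u\<in>V. \<forall>v\<in>V. \<phi> (meet u v) = join G (\<phi> u) (\<phi> v)) \<and>
      \<phi> zero = {} \<and>
      \<phi> one = {Map.empty} \<and>
      (\<forall>x. \<forall>u\<in>V. \<phi> (c x u) = del G x (\<phi> u)) \<and>
      (\<forall>x y. \<phi> (d x y) = eq_table G x y) \<and>
      (\<forall>u\<in>V. schema G (\<phi> u) = domain u)"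
proof -
  interpret P: projectional_semilattice V meet zero one c d domain "\<lambda>u v. u = meet u v"
    by (fact assms(3)) simp
  obtain A where A: "\<And>i. P.henkin_chain (vars i) (P.tasks i) (A i)"
    "\<And>i u v p q j. i = (u, p) # (v, q) # j \<Longrightarrow> P.separable (vars i) u v \<Longrightarrow> P.separates i (A i) u v"
    using P.index_chain_exists[OF assms(2,1)] by metis
  interpret C: chain_family V meet zero one c d domain "\<lambda>u v. u = meet u v" A
    by unfold_locales (use assms(2) A in auto)
  interpret T: table_interpretation V meet zero one c d domain "\<lambda>u v. u = meet u v" C.K C.rep C.Sat
    by (fact C.table_interpretation_Sat) simp
  show ?thesis
    using T.conjunctive_table_algebra_range T.inj_on_table T.table_meet T.table_zero T.table_one
      T.table_c T.table_d T.schema_table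
    by (intro exI[of _ T.G] exI[of _ "T.table ` V"] exI[of _ T.table])
       (simp add: bij_betw_def)
qed

end
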